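(* Let $\theta_0=[\mathrm{vec}(A_0)^T,\mathrm{vec}(M_0)^T]^T$ with $A_0\in\mathbb{R}^{(p_2-r)\times r}$, $\|A_0\|_2<1$, and $M_0\in\mathbb{R}^{p_1\times r}$ of full column rank $r$. Then $D\Sigma(\theta_0)^TD\Sigma(\theta_0)$ is invertible and $$\|\{D\Sigma(\theta_0)^TD\Sigma(\theta_0)\}^{-1}\|_2\le\begin{cases}1+\dfrac{(1+8\|M_0\|_2^2)(1+\|A_0\|_2^2)^4}{4\sigma_r^2(M_0)(1-\|A_0\|_2^2)^2},& r\ge2,\\[2mm]1+\dfrac{(1+8\|M_0\|_2^2)(1+\|A_0\|_2^2)^2}{4\sigma_r^2(M_0)},& r=1.\end{cases}$$
   Context: Fix integers $r\le\min(p_1,p_2)$. For $A\in\mathbb{R}^{(p_2-r)\times r}$ write $\varphi=\mathrm{vec}(A)$, $X_\varphi=\begin{bmatrix}0_{r\times r}&-A^{T}\\ A&0\end{bmatrix}\in\mathbb{R}^{p_2\times p_2}$, $I_{p_2\times r}=\begin{bmatrix}I_r\\0\end{bmatrix}$, Cayley parameterization $U(\varphi)=(I_{p_2}+X_\varphi)(I_{p_2}-X_\varphi)^{-1}I_{p_2\times r}$ with derivative $DU(\varphi)=2[I_{p_2\times r}^T(I_{p_2}-X_\varphi)^{-T}\otimes(I_{p_2}-X_\varphi)^{-1}]\Gamma$, $\Gamma=(I_{p_2^2}-K_{p_2p_2})(\Theta_1^T\otimes\Theta_2^T)$, $\Theta_1=I_{p_2\times r}^T$, $\Theta_2=[0_{(p_2-r)\times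 r},I_{p_2-r}]$; $K_{pq}$ is the commutation matrix ($\mathrm{vec}(N^T)=K_{pq}\mathrm{vec}(N)$ for $N\in\mathbb{R}^{p\times q}$). For $\mu=\mathrm{vec}(M)$, $M\in\mathbb{R}^{p_1\times r}$, and $\theta=[\varphi^T,\mu^T]^T$, set $\Sigma(\theta)=MU(\varphi)^T\in\mathbb{R}^{p_1\times p_2}$, $D_\varphi\Sigma(\theta)=K_{p_2p_1}(M\otimes I_{p_2})DU(\varphi)$, $D_\mu\Sigma(\theta)=U(\varphi)\otimes I_{p_1}$, $D\Sigma(\theta)=[D_\varphi\Sigma(\theta),D_\mu\Sigma(\theta)]$. $\sigma_r(M_0)$ is the $r$-th (smallest) singular value of $M_0$. *)

theory Defs
  imports "Jordan_Normal_Form.Matrix" "Jordan_Normal_Form.DL_Rank" "Jordan_Normal_Form.Char_Poly"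
    "HOL-Library.Multiset"
begin

definition vnorm :: "real vec \<Rightarrow> real" where
  "vnorm v = sqrt (\<Sum>i<dim_vec v. (v $ i)^2)"

definition spec_norm :: "real mat \<Rightarrow> real" where
  "spec_norm A = Sup {vnorm (A *\<^sub>v v) | v. v \<in> carrier_vec (dim_col A) \<and> vnorm v = 1}"

text \<open>Singular values sigma_1 >= sigma_2 >= ...: square roots of the eigenvalues of A^T A
  (with multiplicity), listed in decreasing order; sing_val A k is sigma_k (k >= 1).\<close>
definition sing_vals :: "real mat \<Rightarrow> real list" where
  "sing_vals A = map sqrt (rev (sorted_list_of_multiset
      (proots (char_poly (transpose_mat A * A)))))"

definition sing_val :: "real mat \<Rightarrow> nat \<Rightarrow> real" where
  "sing_val A k = sing_vals A ! (k - 1)"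

definition minv :: "real mat \<Rightarrow> real mat" where
  "minv A = (if invertible_mat A then (THE B. inverts_mat A B \<and> inverts_mat B A)
             else 0\<^sub>m (dim_row A) (dim_col A))"

definition mvec :: "real mat \<Rightarrow> real vec" where
  "mvec M = vec (dim_row M * dim_col M) (\<lambda>k. M $$ (k mod dim_row M, k div dim_row M))"

definition kron :: "real mat \<Rightarrow> real mat \<Rightarrow> real mat" where
  "kron A B = mat (dim_row A * dim_row B) (dim_col A * dim_col B)
     (\<lambda>(i,j). A $$ (i div dim_row B, j div dim_col B) * B $$ (i mod dim_row B, j mod dim_col B))"

text \<open>Commutation matrix K_{pq}: mvec (N^T) = K_{pq} *v mvec N for N of size p x q.\<close>
definition Kcomm :: "nat \<Rightarrow> nat \<Rightarrow> real mat" where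
  "Kcomm p q = mat (p*q) (p*q) (\<lambda>(k,l). if l = k div q + p * (k mod q) then 1 else 0)"

definition hcat :: "real mat \<Rightarrow> real mat \<Rightarrow> real mat" where
  "hcat B C = mat (dim_row B) (dim_col B + dim_col C)
     (\<lambda>(i,j). if j < dim_col B then B $$ (i,j) else C $$ (i, j - dim_col B))"

definition Ipr :: "nat \<Rightarrow> nat \<Rightarrow> real mat" where
  "Ipr p r = mat p r (\<lambda>(i,j). if i = j then 1 else 0)"

definition Xphi :: "nat \<Rightarrow> nat \<Rightarrow> real mat \<Rightarrow> real mat" where
  "Xphi p2 r A = mat p2 p2 (\<lambda>(i,j).
      if r \<le> i \<and> j < r then A $$ (i - r, j)
      else if i < r \<and> r \<le> j then - A $$ (j - r, i) else 0)"

definition Theta1 :: "nat \<Rightarrow> nat \<Rightarrow> real mat" where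
  "Theta1 p2 r = transpose_mat (Ipr p2 r)"

definition Theta2 :: "nat \<Rightarrow> nat \<Rightarrow> real mat" where
  "Theta2 p2 r = mat (p2 - r) p2 (\<lambda>(i,j). if j = i + r then 1 else 0)"

definition Gam :: "nat \<Rightarrow> nat \<Rightarrow> real mat" where
  "Gam p2 r = (1\<^sub>m (p2*p2) - Kcomm p2 p2) *
      kron (transpose_mat (Theta1 p2 r)) (transpose_mat (Theta2 p2 r))"

definition cayU :: "nat \<Rightarrow> nat \<Rightarrow> real mat \<Rightarrow> real mat" where
  "cayU p2 r A = (1\<^sub>m p2 + Xphi p2 r A) * minv (1\<^sub>m p2 - Xphi p2 r A) * Ipr p2 r"

definition DU :: "nat \<Rightarrow> nat \<Rightarrow> real mat \<Rightarrow> real mat" where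
  "DU p2 r A = 2 \<cdot>\<^sub>m (kron (transpose_mat (Ipr p2 r) * transpose_mat (minv (1\<^sub>m p2 - Xphi p2 r A)))
                          (minv (1\<^sub>m p2 - Xphi p2 r A)) * Gam p2 r)"

text \<open>D Sigma(theta) = [D_phi Sigma, D_mu Sigma] at theta = [vec A; vec M].\<close>
definition DSigma :: "nat \<Rightarrow> nat \<Rightarrow> nat \<Rightarrow> real mat \<Rightarrow> real mat \<Rightarrow> real mat" where
  "DSigma p1 p2 r A M =
     hcat (Kcomm p2 p1 * kron M (1\<^sub>m p2) * DU p2 r A) (kron (cayU p2 r A) (1\<^sub>m p1))"

end

theory Submission
  imports Defs "HOL-Analysis.L2_Norm"
begin

text \<open>
  Put \<open>C = (I - X)\<^sup>-\<^sup>1\<close>. The matrix \<open>Q = (I + X) C\<close> is orthogonal, and multiplying the increment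
  \<open>m U\<^sup>T + M (dU)\<^sup>T\<close> by it on the right gives \<open>[m, 0] - 2 [M, 0] W\<close> with the skew matrix
  \<open>W = C\<^sup>T dX C\<close>. The first \<open>r\<close> columns control \<open>m\<close> up to \<open>2 \<parallel>M\<parallel> \<parallel>W\<parallel>\<close>, where \<open>\<parallel>W\<parallel>\<^sup>2 \<le> 2 \<parallel>dA\<parallel>\<^sup>2\<close>
  because \<open>\<parallel>C\<parallel> \<le> 1\<close>; the others have norm at least \<open>2 \<sigma>\<^sub>r(M) \<parallel>V\<parallel>\<close>, where \<open>V\<close> is the upper right
  block of \<open>W\<close>. For \<open>N = I - X\<^sup>2\<close>, whose norm is at most \<open>1 + \<parallel>A\<parallel>\<^sup>2\<close>, the product \<open>N V N\<close> is
  \<open>-(dA + A (dA)\<^sup>T A)\<^sup>T\<close> up to padding with zeros, which bounds \<open>V\<close> from below in terms of \<open>dA\<close>. If \<open>r = 1\<close>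
  the scalar \<open>A\<^sup>T dA\<close> is symmetric and one factor \<open>N\<close> cancels.
\<close>

section \<open>Euclidean, Frobenius and spectral norms\<close>

text \<open>A bound \<open>|z|^2 \<le> K |D z|^2\<close> for all \<open>z\<close> bounds the inverse
  of the Gram matrix of \<open>D\<close> by \<open>K\<close>, so everything rests on estimating the
  parameter increment \<open>(dA, m)\<close> by the increment of \<Sigma>. The obstacle is that the
  two parts of the latter can cancel. After the rotation \<open>m\<close> is confined to the first r
  columns, so the others see \<open>dA\<close> alone and bound it; the first r columns then bound
  \<open>m\<close>, up to what \<open>dA\<close> may have cancelled there. Let \<open>x\<close> and
  \<open>y\<close> be the norms of the two groups of columns, \<open>\<kappa> |dA| \<le> |V|\<close>
  and \<open>s = 4 \<sigma>^2 \<kappa>^2\<close>. Then \<open>|dA|^2 \<le> y^2 / s\<close> and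
  \<open>|m|^2 \<le> (1 + 8 |M|^2 / s) (x^2 + y^2)\<close>, and the sum of the two factors is the
  stated constant. The term \<open>A (dA)^T A\<close> can cancel at most \<open>|A|^2 |dA|\<close>
  of \<open>dA\<close>, which yields \<open>\<kappa> = (1 - |A|^2) / (1 + |A|^2)^2\<close>; this is
  where \<open>|A| < 1\<close> enters. For r = 1 one has
  \<open>\<kappa> = 1 / (1 + |A|^2)\<close>.\<close>

lemma vnorm_L2_set: "vnorm v = L2_set (($) v) {..<dim_vec v}"
  by (simp add: vnorm_def L2_set_def)

lemma vnorm_nonneg [simp]: "0 \<le> vnorm v"
  by (simp add: vnorm_def sum_nonneg)

lemma vnorm_sq: "(vnorm v)\<^sup>2 = v \<bullet> v"
  by (simp add: vnorm_def sum_nonneg scalar_prod_def power2_eq_square lessThan_atLeast0)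

lemma vnorm_smult: "vnorm (c \<cdot>\<^sub>v v) = \<bar>c\<bar> * vnorm v"
  by (simp add: vnorm_def power_mult_distrib flip: sum_distrib_left) (simp add: real_sqrt_mult)

lemma vnorm_eq_0_iff: "vnorm v = 0 \<longleftrightarrow> v = 0\<^sub>v (dim_vec v)"
  by (auto simp: vnorm_L2_set L2_set_eq_0_iff intro!: eq_vecI)
     (metis index_zero_vec(1))

lemma vnorm_zero [simp]: "vnorm (0\<^sub>v n) = 0"
  by (simp add: vnorm_def)

lemma vnorm_triangle:
  assumes "v \<in> carrier_vec n" "w \<in> carrier_vec n"
  shows "vnorm (v + w) \<le> vnorm v + vnorm w"
proof -
  have "vnorm (v + w) = L2_set (\<lambda>i. v $ i + w $ i) {..<n}"
    using assms by (auto simp: vnorm_def L2_set_def)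
  then show ?thesis
    using L2_set_triangle_ineq[of "($) v" "($) w" "{..<n}"] assms by (simp add: vnorm_L2_set)
qed

lemma scalar_prod_le_vnorm:
  assumes "v \<in> carrier_vec n" "w \<in> carrier_vec n"
  shows "\<bar>v \<bullet> w\<bar> \<le> vnorm v * vnorm w"
proof -
  have "\<bar>v \<bullet> w\<bar> \<le> (\<Sum>i<n. \<bar>v $ i\<bar> * \<bar>w $ i\<bar>)"
    using assms sum_abs[of "\<lambda>i. v $ i * w $ i" "{..<n}"]
    by (simp add: scalar_prod_def lessThan_atLeast0 abs_mult)
  also have "\<dots> \<le> vnorm v * vnorm w"
    using L2_set_mult_ineq[of "($) v" "($) w" "{..<n}"] assms by (simp add: vnorm_L2_set)
  finally show ?thesis .
qed

section \<open>Vectorization and the Frobenius norm\<close>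

lemma sum_mod_div:
  fixes f :: "nat \<Rightarrow> nat \<Rightarrow> 'a :: comm_monoid_add"
  assumes "a > 0"
  shows "(\<Sum>k<a * b. f (k mod a) (k div a)) = (\<Sum>j<b. \<Sum>i<a. f i j)"
proof -
  have "(\<Sum>k<a * b. f (k mod a) (k div a))
      = (\<Sum>j<b. \<Sum>k\<in>{j * a..<j * a + a}. f (k mod a) (k div a))"
    by (simp add: sum.nat_group mult.commute)
  also have "\<dots> = (\<Sum>j<b. \<Sum>i<a. f i j)"
  proof (rule sum.cong[OF refl])
    fix j
    have "(\<Sum>k\<in>{j * a..<j * a + a}. f (k mod a) (k div a))
        = (\<Sum>i<a. f ((i + j * a) mod a) ((i + j * a) div a))"
      using sum.shift_bounds_nat_ivl[of "\<lambda>k. f (k mod a) (k div a)" 0 "j * a" a]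
      by (simp add: add.commute lessThan_atLeast0)
    also have "\<dots> = (\<Sum>i<a. f i j)"
      using assms by (intro sum.cong) auto
    finally show "(\<Sum>k\<in>{j * a..<j * a + a}. f (k mod a) (k div a)) = (\<Sum>i<a. f i j)" .
  qed
  finally show ?thesis .
qed

text \<open>Increments of \<open>A\<close>, \<open>M\<close> and \<Sigma> are handled as matrices;
  this is the Euclidean norm of their vectorizations, so the estimate on \<open>DSigma\<close> can
  be proved without Kronecker indices.\<close>

definition frob :: "real mat \<Rightarrow> real" where
  "frob N = sqrt (\<Sum>i<dim_row N. \<Sum>j<dim_col N. (N $$ (i, j))\<^sup>2)"

lemma frob_nonneg [simp]: "0 \<le> frob N"
  by (simp add: frob_def sum_nonneg)

lemma frob_sq: "(frob N)\<^sup>2 = (\<Sum>i<dim_row N. \<Sum>j<dim_col N. (N $$ (i, j))\<^sup>2)"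
  by (simp add: frob_def sum_nonneg)

lemma frob_transpose [simp]: "frob (transpose_mat N) = frob N"
  unfolding frob_def by (subst sum.swap) simp

lemma frob_sq_cols: "(frob N)\<^sup>2 = (\<Sum>j<dim_col N. (vnorm (col N j))\<^sup>2)"
  unfolding frob_sq by (subst sum.swap) (simp add: vnorm_def sum_nonneg)

lemma vnorm_mvec [simp]: "vnorm (mvec N) = frob N"
proof (cases "dim_row N = 0")
  case True
  then show ?thesis by (simp add: vnorm_def mvec_def frob_def)
next
  case False
  then show ?thesis
    using sum_mod_div[of "dim_row N" "\<lambda>i j. (N $$ (i, j))\<^sup>2" "dim_col N"]
    by (simp add: vnorm_def mvec_def frob_def sum.swap[of _ "{..<dim_row N}"])
qed

lemma mvec_index: "k < dim_row N * dim_col N \<Longrightarrow> mvec N $ k = N $$ (k mod dim_row N, k div dim_row N)"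
  by (simp add: mvec_def)

lemma dim_mvec [simp]: "dim_vec (mvec N) = dim_row N * dim_col N"
  by (simp add: mvec_def)

lemma div_mod_bounds:
  assumes "k < a * (b :: nat)"
  shows "k mod a < a" "k div a < b"
proof -
  have "a > 0" using assms by (cases a) auto
  then show "k mod a < a" by simp
  show "k div a < b" using assms by (simp add: less_mult_imp_div_less mult.commute)
qed

lemma mvec_add:
  assumes "N \<in> carrier_mat a b" "L \<in> carrier_mat a b"
  shows "mvec (N + L) = mvec N + mvec L"
  using assms by (intro eq_vecI) (auto simp: mvec_index div_mod_bounds)

lemma mvec_smult: "mvec (c \<cdot>\<^sub>m N) = c \<cdot>\<^sub>v mvec N"
  by (intro eq_vecI) (auto simp: mvec_index div_mod_bounds)

lemma frob_smult: "frob (c \<cdot>\<^sub>m N) = \<bar>c\<bar> * frob N"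
  by (metis vnorm_mvec mvec_smult vnorm_smult)

lemma frob_uminus [simp]: "frob (- N) = frob N"
  by (simp add: frob_def)

lemma frob_triangle:
  assumes "N \<in> carrier_mat a b" "L \<in> carrier_mat a b"
  shows "frob (N + L) \<le> frob N + frob L"
  using vnorm_triangle[of "mvec N" "a * b" "mvec L"] assms
  by (simp add: mvec_add[OF assms, symmetric] carrier_vecI flip: vnorm_mvec)

lemma frob_mult_sq:
  assumes "A \<in> carrier_mat a b" "N \<in> carrier_mat b c"
  shows "(frob (A * N))\<^sup>2 = (\<Sum>j<c. (vnorm (A *\<^sub>v col N j))\<^sup>2)"
proof -
  have "(frob (A * N))\<^sup>2 = (\<Sum>j<c. (vnorm (col (A * N) j))\<^sup>2)"
    using assms by (simp only: frob_sq_cols index_mult_mat carrier_matD)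
  also have "\<dots> = (\<Sum>j<c. (vnorm (A *\<^sub>v col N j))\<^sup>2)"
    by (intro sum.cong refl) (simp only: col_mult2[OF assms] lessThan_iff)
  finally show ?thesis .
qed

text \<open>Applied column by column. The operator bound enters as a hypothesis on vectors rather
  than through \<open>spec_norm\<close>, so that isometries, contractions and bounds on transposes
  can be plugged in directly.\<close>

lemma frob_mult_le:
  assumes "A \<in> carrier_mat a b" "N \<in> carrier_mat b c" "0 \<le> k"
    and "\<And>v. v \<in> carrier_vec b \<Longrightarrow> vnorm (A *\<^sub>v v) \<le> k * vnorm v"
  shows "frob (A * N) \<le> k * frob N"
proof (rule power2_le_imp_le)
  have "(frob (A * N))\<^sup>2 = (\<Sum>j<c. (vnorm (A *\<^sub>v col N j))\<^sup>2)"
    by (rule frob_mult_sq[OF assms(1,2)])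
  also have "\<dots> \<le> (\<Sum>j<c. (k * vnorm (col N j))\<^sup>2)"
    using assms by (intro sum_mono power_mono) auto
  also have "\<dots> = (k * frob N)\<^sup>2"
    using assms(1,2) by (simp add: frob_sq_cols power_mult_distrib sum_distrib_left)
  finally show "(frob (A * N))\<^sup>2 \<le> (k * frob N)\<^sup>2" .
qed (use assms in simp)

lemma frob_mult_ge:
  assumes "A \<in> carrier_mat a b" "N \<in> carrier_mat b c" "0 \<le> k"
    and "\<And>v. v \<in> carrier_vec b \<Longrightarrow> k * vnorm v \<le> vnorm (A *\<^sub>v v)"
  shows "k * frob N \<le> frob (A * N)"
proof (rule power2_le_imp_le)
  have "(k * frob N)\<^sup>2 = (\<Sum>j<c. (k * vnorm (col N j))\<^sup>2)"
    using assms(1,2) by (simp add: frob_sq_cols power_mult_distrib sum_distrib_left)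
  also have "\<dots> \<le> (\<Sum>j<c. (vnorm (A *\<^sub>v col N j))\<^sup>2)"
    using assms by (intro sum_mono power_mono) auto
  also have "\<dots> = (frob (A * N))\<^sup>2"
    by (rule frob_mult_sq[OF assms(1,2), symmetric])
  finally show "(k * frob N)\<^sup>2 \<le> (frob (A * N))\<^sup>2" .
qed simp

lemma scalar_prod_mult_transpose:
  fixes A :: "real mat"
  assumes "A \<in> carrier_mat a b" "v \<in> carrier_vec b" "w \<in> carrier_vec a"
  shows "(A *\<^sub>v v) \<bullet> w = v \<bullet> (transpose_mat A *\<^sub>v w)"
proof -
  have "(A *\<^sub>v v) \<bullet> w = w \<bullet> (A *\<^sub>v v)"
    using assms comm_scalar_prod[of "A *\<^sub>v v" a w] by auto
  also have "\<dots> = (transpose_mat A *\<^sub>v w) \<bullet> v"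
    using transpose_vec_mult_scalar[of A a b v w] assms by simp
  also have "\<dots> = v \<bullet> (transpose_mat A *\<^sub>v w)"
    using assms comm_scalar_prod[of "transpose_mat A *\<^sub>v w" b v] by auto
  finally show ?thesis .
qed

lemma vnorm_mult_isometry:
  assumes A: "A \<in> carrier_mat a b" and iso: "transpose_mat A * A = 1\<^sub>m b" and v: "v \<in> carrier_vec b"
  shows "vnorm (A *\<^sub>v v) = vnorm v"
proof -
  have "(A *\<^sub>v v) \<bullet> (A *\<^sub>v v) = v \<bullet> (transpose_mat A *\<^sub>v (A *\<^sub>v v))"
    using A v by (intro scalar_prod_mult_transpose[OF A]) auto
  also have "transpose_mat A *\<^sub>v (A *\<^sub>v v) = v"
    using A iso v by (subst assoc_mult_mat_vec[symmetric, of _ b a _ b]) auto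
  finally show ?thesis using power2_eq_imp_eq[of "vnorm (A *\<^sub>v v)" "vnorm v"] by (simp add: vnorm_sq)
qed

lemma frob_mult_isometry:
  assumes "A \<in> carrier_mat a b" "N \<in> carrier_mat b c" "transpose_mat A * A = 1\<^sub>m b"
  shows "frob (A * N) = frob N"
  using frob_mult_le[OF assms(1,2), of 1] frob_mult_ge[OF assms(1,2), of 1]
    vnorm_mult_isometry[OF assms(1,3)] by simp

lemma vnorm_mult_le_frob:
  assumes "A \<in> carrier_mat a b" "v \<in> carrier_vec b"
  shows "vnorm (A *\<^sub>v v) \<le> frob A * vnorm v"
proof (rule power2_le_imp_le)
  have "(vnorm (A *\<^sub>v v))\<^sup>2 = (\<Sum>i<a. (row A i \<bullet> v)\<^sup>2)"
    using assms by (auto simp: vnorm_def sum_nonneg)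
  also have "\<dots> \<le> (\<Sum>i<a. (vnorm (row A i) * vnorm v)\<^sup>2)"
  proof (rule sum_mono)
    fix i assume "i \<in> {..<a}"
    then have "\<bar>row A i \<bullet> v\<bar> \<le> vnorm (row A i) * vnorm v"
      using assms by (intro scalar_prod_le_vnorm[of _ b]) auto
    then show "(row A i \<bullet> v)\<^sup>2 \<le> (vnorm (row A i) * vnorm v)\<^sup>2"
      using power_mono[of "\<bar>row A i \<bullet> v\<bar>" _ 2] by simp
  qed
  also have "\<dots> = (frob A * vnorm v)\<^sup>2"
    using assms by (simp add: power_mult_distrib frob_sq sum_distrib_right vnorm_def sum_nonneg)
  finally show "(vnorm (A *\<^sub>v v))\<^sup>2 \<le> (frob A * vnorm v)\<^sup>2" .
qed simp

text \<open>A real \<open>Sup\<close> says nothing without an upper bound on its set; the Frobenius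
  norm is one, by Cauchy-Schwarz on each row.\<close>

lemma spec_norm_bdd_above:
  "bdd_above {vnorm (A *\<^sub>v v) | v. v \<in> carrier_vec (dim_col A) \<and> vnorm v = 1}"
  using vnorm_mult_le_frob[of A "dim_row A" "dim_col A"]
  by (intro bdd_aboveI[of _ "frob A"]) fastforce

lemma vnorm_mult_le_spec_norm:
  assumes "A \<in> carrier_mat a b" "v \<in> carrier_vec b"
  shows "vnorm (A *\<^sub>v v) \<le> spec_norm A * vnorm v"
proof (cases "vnorm v = 0")
  case True
  then show ?thesis using vnorm_mult_le_frob[OF assms] by simp
next
  case False
  define w where "w = (1 / vnorm v) \<cdot>\<^sub>v v"
  have w: "w \<in> carrier_vec b" "vnorm w = 1" using assms False by (auto simp: w_def vnorm_smult)
  have "vnorm (A *\<^sub>v w) \<le> spec_norm A"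
    unfolding spec_norm_def using w assms by (intro cSup_upper spec_norm_bdd_above) auto
  moreover have "vnorm (A *\<^sub>v w) = vnorm (A *\<^sub>v v) / vnorm v"
    using assms by (simp add: w_def mult_mat_vec[of A a b] vnorm_smult)
  ultimately show ?thesis using False by (simp add: field_simps less_le)
qed

lemma unit_vec_vnorm [simp]: "i < n \<Longrightarrow> vnorm (unit_vec n i) = 1"
  using vnorm_sq[of "unit_vec n i"] by (auto simp: power2_eq_1_iff)
     (smt (verit) vnorm_nonneg)

text \<open>The hypothesis \<open>0 < b\<close> supplies a unit vector; otherwise the supremum would
  be over the empty set.\<close>

lemma spec_norm_le:
  assumes "A \<in> carrier_mat a b" "0 < b"
    and "\<And>v. v \<in> carrier_vec b \<Longrightarrow> vnorm v = 1 \<Longrightarrow> vnorm (A *\<^sub>v v) \<le> k"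
  shows "spec_norm A \<le> k"
  unfolding spec_norm_def
proof (rule cSup_least)
  show "{vnorm (A *\<^sub>v v) | v. v \<in> carrier_vec (dim_col A) \<and> vnorm v = 1} \<noteq> {}"
    using assms(1,2) by (auto intro!: exI[of _ "unit_vec b 0"])
qed (use assms in auto)

lemma spec_norm_nonneg:
  assumes "A \<in> carrier_mat a b" "0 < b"
  shows "0 \<le> spec_norm A"
  using vnorm_mult_le_spec_norm[OF assms(1), of "unit_vec b 0"] assms(2)
  by (smt (verit) unit_vec_carrier unit_vec_vnorm vnorm_nonneg mult_cancel_left1)

text \<open>Duality: for \<open>u = A^T w\<close> one has
  \<open>|u|^2 = (A u) \<bullet> w \<le> k |u| |w|\<close>, and a factor \<open>|u|\<close>
  cancels.\<close>

lemma vnorm_transpose_mult_le: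
  assumes A: "A \<in> carrier_mat a b" and w: "w \<in> carrier_vec a" and "0 \<le> k"
    and k: "\<And>v. v \<in> carrier_vec b \<Longrightarrow> vnorm (A *\<^sub>v v) \<le> k * vnorm v"
  shows "vnorm (transpose_mat A *\<^sub>v w) \<le> k * vnorm w"
proof -
  define u where "u = transpose_mat A *\<^sub>v w"
  have u: "u \<in> carrier_vec b" using A w by (simp add: u_def)
  have "(vnorm u)\<^sup>2 = (A *\<^sub>v u) \<bullet> w"
    using scalar_prod_mult_transpose[OF A u w] by (simp add: vnorm_sq u_def)
  also have "\<dots> \<le> vnorm (A *\<^sub>v u) * vnorm w"
    using scalar_prod_le_vnorm[of "A *\<^sub>v u" a w] A u w by auto
  also have "\<dots> \<le> (k * vnorm u) * vnorm w"
    using k[OF u] by (intro mult_right_mono) auto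
  finally have "vnorm u * vnorm u \<le> vnorm u * (k * vnorm w)"
    by (simp add: power2_eq_square algebra_simps)
  then show ?thesis
    using \<open>0 \<le> k\<close> by (cases "vnorm u = 0") (auto simp: u_def less_le)
qed

lemma frob_mult_right_le:
  assumes A: "A \<in> carrier_mat b c" and N: "N \<in> carrier_mat a b" and k: "0 \<le> k"
    and le: "\<And>v. v \<in> carrier_vec c \<Longrightarrow> vnorm (A *\<^sub>v v) \<le> k * vnorm v"
  shows "frob (N * A) \<le> k * frob N"
proof -
  have "frob (transpose_mat A * transpose_mat N) \<le> k * frob (transpose_mat N)"
    using A N k vnorm_transpose_mult_le[OF A _ k le]
    by (intro frob_mult_le[of _ c b _ a]) auto
  then show ?thesis using transpose_mult[OF N A] by (metis frob_transpose)
qed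

text \<open>The classical vec identity. It turns the Kronecker formulas behind \<open>DU\<close> and
  \<open>DSigma\<close> into ordinary matrix products.\<close>

lemma kron_mult_mvec:
  assumes P: "P \<in> carrier_mat a b" and Q: "Q \<in> carrier_mat c d" and N: "N \<in> carrier_mat d b"
  shows "kron P Q *\<^sub>v mvec N = mvec (Q * N * transpose_mat P)"
proof (rule eq_vecI)
  fix k assume "k < dim_vec (mvec (Q * N * transpose_mat P))"
  then have k: "k < c * a" using P Q N by simp
  note kb = div_mod_bounds[OF k]
  have rhs: "mvec (Q * N * transpose_mat P) $ k
     = (\<Sum>j<b. (\<Sum>i<d. Q $$ (k mod c, i) * N $$ (i, j)) * P $$ (k div c, j))"
    using P Q N k kb
    by (subst mvec_index) (simp_all add: scalar_prod_def lessThan_atLeast0 del: assoc_mult_mat)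
  have lhs: "(kron P Q *\<^sub>v mvec N) $ k
     = (\<Sum>l<d * b. P $$ (k div c, l div d) * Q $$ (k mod c, l mod d) * N $$ (l mod d, l div d))"
    using P Q N k by (auto simp: kron_def scalar_prod_def lessThan_atLeast0 mvec_index mult.commute intro!: sum.cong)
  show "(kron P Q *\<^sub>v mvec N) $ k = mvec (Q * N * transpose_mat P) $ k"
  \<comment> \<open>Splitting the index by \<open>mod d\<close> and \<open>div d\<close> requires a
    positive block length.\<close>
  proof (cases "d = 0")
    case True then show ?thesis unfolding lhs rhs by simp
  next
    case False
    then show ?thesis unfolding lhs rhs
      by (subst sum_mod_div[of d "\<lambda>i j. P $$ (k div c, j) * Q $$ (k mod c, i) * N $$ (i, j)"])
         (auto simp: sum_distrib_left sum_distrib_right mult_ac)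
  qed
qed (use assms in \<open>simp add: kron_def\<close>)

lemma Kcomm_mult_mvec:
  assumes N: "N \<in> carrier_mat p q"
  shows "Kcomm p q *\<^sub>v mvec N = mvec (transpose_mat N)"
proof (rule eq_vecI)
  fix k assume "k < dim_vec (mvec (transpose_mat N))"
  then have k: "k < q * p" using N by simp
  note kb = div_mod_bounds[OF k]
  \<comment> \<open>The column of the only 1 in row \<open>k\<close> of the commutation matrix, that
    is, the position of the entry \<open>(k div q, k mod q)\<close> in
    \<open>mvec N\<close>.\<close>
  define l where "l = k div q + p * (k mod q)"
  have l: "l < p * q"
  proof -
    have "l < p * Suc (k mod q)" using kb by (simp add: l_def)
    also have "\<dots> \<le> p * q" using kb by (intro mult_le_mono2) simp
    finally show ?thesis .
  qed
  have lm: "l mod p = k div q" "l div p = k mod q" using kb by (auto simp: l_def)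
  have "(Kcomm p q *\<^sub>v mvec N) $ k = (\<Sum>i\<in>{0..<p * q}. (if i = l then 1 else 0) * mvec N $ i)"
    using k N by (simp add: Kcomm_def scalar_prod_def l_def mult.commute[of q p])
  also have "\<dots> = (\<Sum>i\<in>{0..<p * q}. if i = l then mvec N $ i else 0)"
    by (intro sum.cong) auto
  also have "\<dots> = mvec N $ l" using l by simp
  also have "\<dots> = mvec (transpose_mat N) $ k"
    using N l k kb lm by (simp add: mvec_index)
  finally show "(Kcomm p q *\<^sub>v mvec N) $ k = mvec (transpose_mat N) $ k" .
qed (use assms in \<open>simp add: Kcomm_def mult.commute\<close>)

section \<open>Smallest eigenvalues and singular values\<close>

lemma minv_eqI:
  assumes "A \<in> carrier_mat n n" "B \<in> carrier_mat n n" "A * B = 1\<^sub>m n"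
  shows "invertible_mat A" "minv A = B"
proof -
  have BA: "B * A = 1\<^sub>m n" using mat_mult_left_right_inverse assms by blast
  show inv: "invertible_mat A"
    using assms BA by (auto simp: invertible_mat_def inverts_mat_def)
  have "(THE B. inverts_mat A B \<and> inverts_mat B A) = B"
  proof (rule the_equality)
    fix C assume C: "inverts_mat A C \<and> inverts_mat C A"
    then have AC: "A * C = 1\<^sub>m n" and CA: "C * A = 1\<^sub>m (dim_row C)"
      using assms(1) by (auto simp: inverts_mat_def)
    \<comment> \<open>\<open>inverts_mat\<close> does not fix the shape of \<open>C\<close>;
      comparing the dimensions of both products with those of the identities does.\<close>
    have "dim_col (A * C) = n" "dim_col (C * A) = dim_row C" unfolding AC CA by simp_all
    then have Cc: "C \<in> carrier_mat n n" using assms(1) by auto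
    have "C = C * (A * B)" using Cc assms by simp
    also have "\<dots> = (C * A) * B" using Cc assms(1,2) by simp
    also have "\<dots> = B" using CA Cc assms(2) by simp
    finally show "C = B" .
  qed (use assms BA in \<open>simp add: inverts_mat_def\<close>)
  then show "minv A = B" using inv by (simp add: minv_def)
qed

lemma injective_mat_inverse:
  assumes A: "(A :: real mat) \<in> carrier_mat n n"
    and inj: "\<And>v. v \<in> carrier_vec n \<Longrightarrow> A *\<^sub>v v = 0\<^sub>v n \<Longrightarrow> v = 0\<^sub>v n"
  obtains B where "B \<in> carrier_mat n n" "A * B = 1\<^sub>m n" "B * A = 1\<^sub>m n"
proof -
  have "det A \<noteq> 0" using det_0_iff_vec_prod_zero_field[OF A] inj by auto
  from det_non_zero_imp_unit[OF A this, of "()"] show thesis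
    using that by (auto simp: Units_def ring_mat_def)
qed

lemma vnorm_sq_eq_0_iff: "v \<in> carrier_vec n \<Longrightarrow> (vnorm v)\<^sup>2 = 0 \<longleftrightarrow> v = 0\<^sub>v n"
  using vnorm_eq_0_iff[of v] by auto

text \<open>For a unit vector \<open>v\<close> and \<open>w = G^-1 v\<close> the hypothesis reads
  \<open>|w|^2 \<le> K (w \<bullet> G w) = K (w \<bullet> v) \<le> K |w|\<close>, hence
  \<open>|w| \<le> K\<close>. The same hypothesis makes the kernel of \<open>G\<close>
  trivial.\<close>

lemma spec_norm_minv_gram_le:
  assumes D: "D \<in> carrier_mat a b" and b: "0 < b"
    and lower: "\<And>z. z \<in> carrier_vec b \<Longrightarrow> (vnorm z)\<^sup>2 \<le> K * (vnorm (D *\<^sub>v z))\<^sup>2"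
  shows "invertible_mat (transpose_mat D * D)" "spec_norm (minv (transpose_mat D * D)) \<le> K"
proof -
  define G where "G = transpose_mat D * D"
  have G: "G \<in> carrier_mat b b" using D by (simp add: G_def)
  have quad: "(vnorm (D *\<^sub>v z))\<^sup>2 = z \<bullet> (G *\<^sub>v z)" if "z \<in> carrier_vec b" for z
    using scalar_prod_mult_transpose[OF D that, of "D *\<^sub>v z"] D that
    by (simp add: vnorm_sq G_def)
  have "z = 0\<^sub>v b" if "z \<in> carrier_vec b" "G *\<^sub>v z = 0\<^sub>v b" for z
  proof -
    have "(vnorm z)\<^sup>2 = 0" using lower[OF that(1)] quad[OF that(1)] that
      by (metis mult_zero_right order_antisym scalar_prod_right_zero zero_le_power2)
    then show ?thesis using vnorm_sq_eq_0_iff[OF that(1)] by simp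
  qed
  then obtain N where N: "N \<in> carrier_mat b b" "G * N = 1\<^sub>m b"
    using injective_mat_inverse[OF G] by metis
  show "invertible_mat (transpose_mat D * D)" using minv_eqI[OF G N] by (simp add: G_def)
  have "spec_norm N \<le> K"
  proof (rule spec_norm_le[OF N(1) b])
    fix v assume v: "v \<in> carrier_vec b" "vnorm v = 1"
    define w where "w = N *\<^sub>v v"
    have w: "w \<in> carrier_vec b" using N v by (simp add: w_def)
    have Gw: "G *\<^sub>v w = v" using N v G
      by (simp add: w_def assoc_mult_mat_vec[symmetric, of _ b b _ b] del: assoc_mult_mat_vec)
    have le: "(vnorm w)\<^sup>2 \<le> K * (w \<bullet> v)" using lower[OF w] quad[OF w] Gw by simp
    have wv: "w \<bullet> v \<le> vnorm w" using scalar_prod_le_vnorm[OF w v(1)] v(2) by simp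
    show "vnorm (N *\<^sub>v v) \<le> K"
    proof (cases "vnorm w = 0")
      case True
      have "w = 0\<^sub>v b" using True w vnorm_eq_0_iff[of w] by simp
      moreover have "G *\<^sub>v 0\<^sub>v b = 0\<^sub>v b" using G by (intro eq_vecI) auto
      ultimately have "v = 0\<^sub>v b" using Gw by simp
      then show ?thesis using v by simp
    next
      case False
      \<comment> \<open>The sign of \<open>K\<close> is not assumed; the hypothesis at a nonzero
        \<open>w\<close> forces it.\<close>
      have "K \<ge> 0"
      proof (rule ccontr)
        assume "\<not> 0 \<le> K"
        then have "K * (vnorm (D *\<^sub>v w))\<^sup>2 \<le> 0" by (simp add: mult_nonpos_nonneg)
        then have "(vnorm w)\<^sup>2 \<le> 0" using lower[OF w] by linarith
        then show False using False by simp
      qed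
      then have "(vnorm w)\<^sup>2 \<le> K * vnorm w"
        using le wv by (meson mult_left_mono order_trans)
      then show ?thesis using False by (simp add: w_def power2_eq_square less_le)
    qed
  qed
  then show "spec_norm (minv (transpose_mat D * D)) \<le> K" using minv_eqI[OF G N] by (simp add: G_def)
qed

text \<open>The infimum \<open>\<mu>\<close> of the quadratic form on the unit sphere is an eigenvalue: otherwise \<open>H - \<mu> I\<close> is
  positive semidefinite and invertible, so its quadratic form is bounded away from \<open>0\<close> on the sphere.
  No compactness is needed.\<close>
lemma least_eigenvalue_le_quadratic_form:
  assumes H: "(H :: real mat) \<in> carrier_mat n n" and sym: "transpose_mat H = H" and n: "0 < n"
  obtains \<mu> where "eigenvalue H \<mu>"
    "\<And>v. v \<in> carrier_vec n \<Longrightarrow> \<mu> * (vnorm v)\<^sup>2 \<le> v \<bullet> (H *\<^sub>v v)"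
proof -
  define S where "S = {v \<bullet> (H *\<^sub>v v) | v. v \<in> carrier_vec n \<and> vnorm v = 1}"
  define \<mu> where "\<mu> = Inf S"
  have S_ne: "S \<noteq> {}" using n by (auto simp: S_def intro!: exI[of _ "unit_vec n 0"])
  have "- frob H \<le> s" if s: "s \<in> S" for s
  proof -
    obtain v where v: "v \<in> carrier_vec n" "vnorm v = 1" "s = v \<bullet> (H *\<^sub>v v)"
      using s by (auto simp: S_def)
    then show ?thesis
      using scalar_prod_le_vnorm[of v n "H *\<^sub>v v"] vnorm_mult_le_frob[OF H v(1)] H by auto
  qed
  then have bdd: "bdd_below S" by (rule bdd_belowI)
  have quad: "\<mu> * (vnorm v)\<^sup>2 \<le> v \<bullet> (H *\<^sub>v v)" if v: "v \<in> carrier_vec n" for v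
  proof (cases "vnorm v = 0")
    case True
    then show ?thesis using vnorm_sq_eq_0_iff[OF v] H by simp
  next
    case False
    define w where "w = (1 / vnorm v) \<cdot>\<^sub>v v"
    have w: "w \<in> carrier_vec n" "vnorm w = 1" using v False by (auto simp: w_def vnorm_smult)
    have "\<mu> \<le> w \<bullet> (H *\<^sub>v w)"
      unfolding \<mu>_def using w by (intro cInf_lower bdd) (auto simp: S_def)
    also have "w \<bullet> (H *\<^sub>v w) = (v \<bullet> (H *\<^sub>v v)) / (vnorm v)\<^sup>2"
      using v H by (simp add: w_def mult_mat_vec[OF H v] power2_eq_square)
    finally show ?thesis using False by (simp add: field_simps)
  qed
  define P where "P = H - \<mu> \<cdot>\<^sub>m 1\<^sub>m n"
  have P: "P \<in> carrier_mat n n" using H by (simp add: P_def minus_carrier_mat)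
  have Pv: "P *\<^sub>v v = H *\<^sub>v v - \<mu> \<cdot>\<^sub>v v" if v: "v \<in> carrier_vec n" for v
    unfolding P_def using H v by (subst minus_mult_distrib_mat_vec[of _ n n]) auto
  have Psym: "transpose_mat P = P"
    unfolding P_def using H sym by (subst transpose_minus[of _ n n]) auto
  have Pquad: "v \<bullet> (P *\<^sub>v v) = v \<bullet> (H *\<^sub>v v) - \<mu> * (vnorm v)\<^sup>2" if v: "v \<in> carrier_vec n" for v
    using v H by (simp add: Pv scalar_prod_minus_distrib[of v n] vnorm_sq)
  have "eigenvalue H \<mu>"
  proof (rule ccontr)
    assume not_ev: "\<not> eigenvalue H \<mu>"
    have "v = 0\<^sub>v n" if v: "v \<in> carrier_vec n" "P *\<^sub>v v = 0\<^sub>v n" for v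
    proof (rule ccontr)
      assume "v \<noteq> 0\<^sub>v n"
      moreover have "H *\<^sub>v v = \<mu> \<cdot>\<^sub>v v"
      proof (rule eq_vecI)
        fix i assume i: "i < dim_vec (\<mu> \<cdot>\<^sub>v v)"
        have "(H *\<^sub>v v - \<mu> \<cdot>\<^sub>v v) $ i = 0\<^sub>v n $ i" using Pv[OF v(1)] v(2) by simp
        then show "(H *\<^sub>v v) $ i = (\<mu> \<cdot>\<^sub>v v) $ i" using i H v(1) by simp
      qed (use H v in simp)
      ultimately show False using not_ev v H by (auto simp: eigenvalue_def eigenvector_def)
    qed
    then obtain N where N: "N \<in> carrier_mat n n" "P * N = 1\<^sub>m n" "N * P = 1\<^sub>m n"
      using injective_mat_inverse[OF P] by metis
    \<comment> \<open>Step length of a descent step along \<open>P v\<close>. The added 1 keeps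
      \<open>t\<close> positive and finite even if \<open>P\<close> vanishes, while
      \<open>t * frob P \<le> 1\<close> still holds.\<close>
    define t where "t = 1 / (frob P + 1)"
    have fP: "0 < frob P + 1" and fN: "0 < frob N + 1" by (simp_all add: add_nonneg_pos)
    have t: "0 < t" "t * frob P \<le> 1"
      using fP by (simp_all add: t_def divide_le_eq_1)
    \<comment> \<open>The size of the gap: \<open>v = N P v\<close> gives
      \<open>1 \<le> frob N * |P v|\<close> for unit \<open>v\<close>, so \<open>c\<close> is a
      lower bound for \<open>t |P v|^2\<close>.\<close>
    define c where "c = t / (frob N + 1)\<^sup>2"
    have c: "c > 0" using t fN by (simp add: c_def)
    have strict: "\<mu> + c \<le> s" if s: "s \<in> S" for s
    proof -
      obtain v where v: "v \<in> carrier_vec n" "vnorm v = 1" "s = v \<bullet> (H *\<^sub>v v)"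
        using s by (auto simp: S_def)
      define w where "w = P *\<^sub>v v"
      have w: "w \<in> carrier_vec n" using P v by (simp add: w_def)
      have "N *\<^sub>v w = v" using N P v
        by (simp add: w_def assoc_mult_mat_vec[symmetric, of _ n n _ n] del: assoc_mult_mat_vec)
      then have "1 \<le> frob N * vnorm w" using vnorm_mult_le_frob[OF N(1) w] v by simp
      also have "\<dots> \<le> (frob N + 1) * vnorm w" by (intro mult_right_mono) auto
      finally have "1 \<le> ((frob N + 1) * vnorm w)\<^sup>2" by simp
      then have c_le: "c \<le> t * (vnorm w)\<^sup>2"
        using t(1) fN by (simp add: c_def power_mult_distrib pos_divide_le_eq mult_ac)
      \<comment> \<open>Nonnegativity of the form of \<open>P\<close> at the displaced point
        \<open>v - t P v\<close> gives \<open>t |P v|^2 \<le> v \<bullet> P v\<close>, because the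
        second order term \<open>t^2 (w \<bullet> P w)\<close> uses up only one of the two copies of
        \<open>t |w|^2\<close>.\<close>
      define u where "u = v - t \<cdot>\<^sub>v w"
      have u: "u \<in> carrier_vec n" using v w by (simp add: u_def)
      have vPw: "v \<bullet> (P *\<^sub>v w) = (vnorm w)\<^sup>2"
        using scalar_prod_mult_transpose[OF P v(1) w] Psym by (simp add: vnorm_sq w_def)
      have Pw: "P *\<^sub>v w \<in> carrier_vec n" using P w by simp
      have wPw: "w \<bullet> (P *\<^sub>v w) \<le> frob P * (vnorm w)\<^sup>2"
      proof -
        have "w \<bullet> (P *\<^sub>v w) \<le> vnorm w * vnorm (P *\<^sub>v w)"
          using scalar_prod_le_vnorm[OF w Pw] by simp
        also have "\<dots> \<le> vnorm w * (frob P * vnorm w)"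
          using vnorm_mult_le_frob[OF P w] by (intro mult_left_mono) auto
        finally show ?thesis by (simp add: power2_eq_square mult_ac)
      qed
      have "0 \<le> u \<bullet> (P *\<^sub>v u)" using quad[OF u] Pquad[OF u] by simp
      also have "P *\<^sub>v u = w - t \<cdot>\<^sub>v (P *\<^sub>v w)"
        unfolding u_def using P v w
        by (subst mult_minus_distrib_mat_vec[of _ n n]) (auto simp: mult_mat_vec[OF P w] w_def)
      also have "u \<bullet> (w - t \<cdot>\<^sub>v (P *\<^sub>v w))
          = v \<bullet> w - 2 * t * (vnorm w)\<^sup>2 + t * (t * (w \<bullet> (P *\<^sub>v w)))"
        unfolding u_def using v(1) w Pw vPw
        by (simp add: minus_scalar_prod_distrib[of _ n] scalar_prod_minus_distrib[of _ n]
            vnorm_sq algebra_simps)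
      also have "t * (t * (w \<bullet> (P *\<^sub>v w))) \<le> t * (vnorm w)\<^sup>2"
      proof -
        have "t * (w \<bullet> (P *\<^sub>v w)) \<le> t * (frob P * (vnorm w)\<^sup>2)"
          using wPw t by (intro mult_left_mono) auto
        also have "\<dots> \<le> 1 * (vnorm w)\<^sup>2"
          using t by (subst mult.assoc[symmetric], intro mult_right_mono) auto
        finally show ?thesis using t by simp
      qed
      finally have "t * (vnorm w)\<^sup>2 \<le> v \<bullet> w" by simp
      then show ?thesis using c_le Pquad[OF v(1)] v(2,3) by (simp add: w_def)
    qed
    have "\<mu> + c \<le> Inf S" using strict by (intro cInf_greatest[OF S_ne])
    then show False using c by (simp add: \<mu>_def)
  qed
  then show thesis using that quad by blast
qed

text \<open>With \<open>v = x + i y\<close> the eigenvalue equation splits into real equations for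
  \<open>H x\<close> and \<open>H y\<close>. Equating \<open>(H x) \<bullet> y\<close> with
  \<open>x \<bullet> (H y)\<close> leaves \<open>Im \<kappa> * (|x|^2 + |y|^2) = 0\<close>, so real
  scalar products suffice.\<close>

lemma eigenvalue_symmetric_real:
  assumes H: "(H :: real mat) \<in> carrier_mat n n" and sym: "transpose_mat H = H"
    and ev: "eigenvalue (map_mat complex_of_real H) \<kappa>"
  shows "Im \<kappa> = 0"
proof -
  obtain v where v: "v \<in> carrier_vec n" "v \<noteq> 0\<^sub>v n"
      and Hv: "map_mat complex_of_real H *\<^sub>v v = \<kappa> \<cdot>\<^sub>v v"
    using ev H by (auto simp: eigenvalue_def eigenvector_def)
  define x y where "x = map_vec Re v" and "y = map_vec Im v"
  have xy: "x \<in> carrier_vec n" "y \<in> carrier_vec n" using v by (auto simp: x_def y_def)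
  have comp: "(\<Sum>j<n. complex_of_real (H $$ (i, j)) * v $ j) = \<kappa> * v $ i" if "i < n" for i
    using arg_cong[OF Hv, of "\<lambda>w. w $ i"] that H v
    by (simp add: scalar_prod_def lessThan_atLeast0)
  have Hx: "H *\<^sub>v x = Re \<kappa> \<cdot>\<^sub>v x - Im \<kappa> \<cdot>\<^sub>v y"
  proof (rule eq_vecI)
    fix i assume "i < dim_vec (Re \<kappa> \<cdot>\<^sub>v x - Im \<kappa> \<cdot>\<^sub>v y)"
    then have i: "i < n" using xy by simp
    show "(H *\<^sub>v x) $ i = (Re \<kappa> \<cdot>\<^sub>v x - Im \<kappa> \<cdot>\<^sub>v y) $ i"
      using arg_cong[OF comp[OF i], of Re] i H v
      by (simp add: scalar_prod_def lessThan_atLeast0 x_def y_def)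
  qed (use H xy in simp)
  have Hy: "H *\<^sub>v y = Im \<kappa> \<cdot>\<^sub>v x + Re \<kappa> \<cdot>\<^sub>v y"
  proof (rule eq_vecI)
    fix i assume "i < dim_vec (Im \<kappa> \<cdot>\<^sub>v x + Re \<kappa> \<cdot>\<^sub>v y)"
    then have i: "i < n" using xy by simp
    show "(H *\<^sub>v y) $ i = (Im \<kappa> \<cdot>\<^sub>v x + Re \<kappa> \<cdot>\<^sub>v y) $ i"
      using arg_cong[OF comp[OF i], of Im] i H v
      by (simp add: scalar_prod_def lessThan_atLeast0 x_def y_def)
  qed (use H xy in simp)
  have "(H *\<^sub>v x) \<bullet> y = x \<bullet> (H *\<^sub>v y)"
    using scalar_prod_mult_transpose[OF H xy] sym by simp
  then have "Im \<kappa> * (x \<bullet> x + y \<bullet> y) = 0"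
    unfolding Hx Hy using xy
    by (simp add: minus_scalar_prod_distrib[of _ n] scalar_prod_add_distrib[of _ n] algebra_simps)
  moreover have "x \<bullet> x + y \<bullet> y \<noteq> 0"
  proof
    assume "x \<bullet> x + y \<bullet> y = 0"
    then have "(vnorm x)\<^sup>2 = 0 \<and> (vnorm y)\<^sup>2 = 0"
      by (simp add: vnorm_sq[symmetric] sum_power2_eq_zero_iff)
    then have "x = 0\<^sub>v n" "y = 0\<^sub>v n" using vnorm_sq_eq_0_iff xy by auto
    have "v = 0\<^sub>v n"
    proof (rule eq_vecI)
      fix i assume "i < dim_vec (0\<^sub>v n :: complex vec)"
      then show "v $ i = 0\<^sub>v n $ i"
        using arg_cong[OF \<open>x = 0\<^sub>v n\<close>, of "\<lambda>w. w $ i"] arg_cong[OF \<open>y = 0\<^sub>v n\<close>, of "\<lambda>w. w $ i"] v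
        by (simp add: x_def y_def complex_eq_iff)
    qed (use v in simp)
    then show False using v by simp
  qed
  ultimately show ?thesis by simp
qed

text \<open>Without this count, \<open>sing_val M r\<close> could be an out-of-range list access.\<close>
lemma size_proots_char_poly_symmetric:
  assumes H: "(H :: real mat) \<in> carrier_mat n n" and sym: "transpose_mat H = H"
  shows "size (proots (char_poly H)) = n"
proof -
  let ?Hc = "map_mat complex_of_real H"
  have Hc: "?Hc \<in> carrier_mat n n" using H by simp
  obtain as where as: "char_poly ?Hc = (\<Prod>a\<leftarrow>as. [:- a, 1:])" "length as = n"
    using char_poly_factorized[OF Hc] by blast
  have real: "complex_of_real (Re a) = a" if "a \<in> set as" for a
  proof -
    have "poly (char_poly ?Hc) a = 0"
      unfolding as(1) using that by (auto simp: poly_prod_list prod_list_zero_iff)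
    then have "eigenvalue ?Hc a" using eigenvalue_root_char_poly[OF Hc] by simp
    then have "Im a = 0" using eigenvalue_symmetric_real[OF H sym] by simp
    then show ?thesis by (simp add: complex_eq_iff)
  qed
  interpret h: map_poly_inj_comm_ring_hom complex_of_real ..
  \<comment> \<open>Since all complex roots are real, the complex factorization is the image of a
    real one, and injectivity of the embedding of polynomials brings it back to
    \<open>char_poly H\<close>.\<close>
  have "map_poly complex_of_real (\<Prod>a\<leftarrow>as. [:- Re a, 1:]) = (\<Prod>a\<leftarrow>as. [:- a, 1:])"
    unfolding h.hom_prod_list using real by (auto simp: o_def intro!: arg_cong[of _ _ prod_list])
  also have "\<dots> = map_poly complex_of_real (char_poly H)"
    unfolding as(1)[symmetric] by (rule of_real_hom.char_poly_hom[OF H])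
  finally have "char_poly H = (\<Prod>a\<leftarrow>as. [:- Re a, 1:])" by (simp add: eq_commute)
  also have "proots \<dots> = mset (map Re as)"
    by (subst proots_prod_list[of "map (\<lambda>a. [:- Re a, 1:]) as", simplified])
       (auto simp: o_def mset_map intro: simp flip: sum_mset_sum_list)
  finally show ?thesis using as(2) by simp
qed

text \<open>The rank only sees the set of columns, so linear independence has to be preceded by
  distinctness: a repeated column would leave fewer than \<open>r\<close> vectors to span the column
  space.\<close>

lemma full_column_rank_injective:
  assumes M: "(M :: real mat) \<in> carrier_mat p r" and rank: "vec_space.rank p M = r"
    and v: "v \<in> carrier_vec r" "M *\<^sub>v v = 0\<^sub>v p"
  shows "v = 0\<^sub>v r"
proof -
  interpret vec_space "TYPE(real)" p .
  have "distinct (cols M)"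
  proof (rule ccontr)
    assume "\<not> distinct (cols M)"
    then have less: "card (set (cols M)) < r"
      using M card_length[of "cols M"] card_distinct[of "cols M"] by force
    obtain S where S: "maximal S (\<lambda>T. T \<subseteq> set (cols M) \<and> lin_indpt T)"
      using maximal_exists[of "(\<lambda>T. T \<subseteq> set (cols M) \<and> lin_indpt T)" "card (set (cols M))" "{}"]
      by (meson List.finite_set card_mono empty_iff empty_subsetI finite_lin_indpt2 rev_finite_subset)
    then have "card S \<le> card (set (cols M))" by (simp add: card_mono maximal_def)
    then show False using rank_card_indpt[OF M S] rank less by simp
  qed
  then show ?thesis
    using full_rank_lin_indpt[OF M rank] lin_depI[OF M v(1) _ v(2)] by blast
qed

text \<open>The square of the last singular value is the least eigenvalue of the Gram matrix, which
  bounds its quadratic form \<open>|M v|^2\<close> from below. It is positive because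
  \<open>M\<close> does not annihilate the corresponding eigenvector.\<close>

lemma sing_val_lower_bound:
  assumes M: "(M :: real mat) \<in> carrier_mat p r" and r: "0 < r"
    and inj: "\<And>v. v \<in> carrier_vec r \<Longrightarrow> M *\<^sub>v v = 0\<^sub>v p \<Longrightarrow> v = 0\<^sub>v r"
  shows "0 < sing_val M r"
    and "\<And>v. v \<in> carrier_vec r \<Longrightarrow> sing_val M r * vnorm v \<le> vnorm (M *\<^sub>v v)"
proof -
  define H where "H = transpose_mat M * M"
  have H: "H \<in> carrier_mat r r" using M by (simp add: H_def)
  have sym: "transpose_mat H = H" unfolding H_def using M by (subst transpose_mult[of _ r p]) auto
  have quad: "(vnorm (M *\<^sub>v v))\<^sup>2 = v \<bullet> (H *\<^sub>v v)" if "v \<in> carrier_vec r" for v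
    using scalar_prod_mult_transpose[OF M that, of "M *\<^sub>v v"] M that
    by (simp add: vnorm_sq H_def)
  define L where "L = sorted_list_of_multiset (proots (char_poly H))"
  have len: "length L = r"
    using size_proots_char_poly_symmetric[OF H sym] by (simp add: L_def flip: size_mset)
  have nz: "char_poly H \<noteq> 0" using degree_monic_char_poly[OF H] by auto
  have set_L: "set L = {k. eigenvalue H k}"
    using nz eigenvalue_root_char_poly[OF H] by (simp add: L_def)
  \<comment> \<open>\<open>L\<close> is ascending and \<open>sing_vals\<close> reverses it, so index
    \<open>r - 1\<close> there is index 0 here.\<close>
  have sv: "sing_val M r = sqrt (L ! 0)"
    using len r by (simp add: sing_val_def sing_vals_def rev_nth flip: H_def L_def)
  have L0: "eigenvalue H (L ! 0)" using set_L len r nth_mem[of 0 L] by simp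
  obtain v where v: "v \<in> carrier_vec r" "v \<noteq> 0\<^sub>v r" "H *\<^sub>v v = (L ! 0) \<cdot>\<^sub>v v"
    using L0 H by (auto simp: eigenvalue_def eigenvector_def)
  have "M *\<^sub>v v \<noteq> 0\<^sub>v p" using inj v by auto
  then have "0 < (vnorm (M *\<^sub>v v))\<^sup>2"
    using vnorm_sq_eq_0_iff[of "M *\<^sub>v v" p] M v by (simp add: zero_less_power2)
  also have "\<dots> = L ! 0 * (vnorm v)\<^sup>2" using quad[OF v(1)] v by (simp add: vnorm_sq)
  finally have pos: "0 < L ! 0" by (simp add: zero_less_mult_iff)
  then show "0 < sing_val M r" by (simp add: sv)
  obtain \<mu> where \<mu>: "eigenvalue H \<mu>"
      "\<And>v. v \<in> carrier_vec r \<Longrightarrow> \<mu> * (vnorm v)\<^sup>2 \<le> v \<bullet> (H *\<^sub>v v)"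
    using least_eigenvalue_le_quadratic_form[OF H sym r] by metis
  have "L ! 0 \<le> \<mu>"
  proof -
    obtain i where "i < length L" "L ! i = \<mu>" using \<mu>(1) set_L by (metis in_set_conv_nth mem_Collect_eq)
    then show ?thesis
      using sorted_nth_mono[of L 0 i] sorted_sorted_list_of_multiset[of "proots (char_poly H)"]
      by (simp add: L_def)
  qed
  fix v :: "real vec" assume v: "v \<in> carrier_vec r"
  show "sing_val M r * vnorm v \<le> vnorm (M *\<^sub>v v)"
  proof (rule power2_le_imp_le)
    have "(sing_val M r * vnorm v)\<^sup>2 = L ! 0 * (vnorm v)\<^sup>2"
      using pos by (simp add: sv power_mult_distrib)
    also have "\<dots> \<le> \<mu> * (vnorm v)\<^sup>2" using \<open>L ! 0 \<le> \<mu>\<close> by (intro mult_right_mono) auto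
    also have "\<dots> \<le> (vnorm (M *\<^sub>v v))\<^sup>2" using \<mu>(2)[OF v] quad[OF v] by simp
    finally show "(sing_val M r * vnorm v)\<^sup>2 \<le> (vnorm (M *\<^sub>v v))\<^sup>2" .
  qed simp
qed

section \<open>The derivative of the Cayley transform in block form\<close>

text \<open>Right-nested products, the normal form used below, hide a vanishing product of the first
  two factors; this recovers it.\<close>

lemma zero_mult_assoc:
  fixes A B Y :: "'a :: semiring_0 mat"
  assumes "A * B = 0\<^sub>m a c" "A \<in> carrier_mat a b" "B \<in> carrier_mat b c" "Y \<in> carrier_mat c d"
  shows "A * (B * Y) = 0\<^sub>m a d"
  using assms(1) assoc_mult_mat[OF assms(2-4)] left_mult_zero_mat[OF assms(4), of a] by simp

section \<open>Pythagorean splittings by an orthogonal projection\<close>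

lemma vnorm_split:
  assumes P: "P \<in> carrier_mat n n" "transpose_mat P = P" "P * P = P" and v: "v \<in> carrier_vec n"
  shows "(vnorm (P *\<^sub>v v))\<^sup>2 + (vnorm ((1\<^sub>m n - P) *\<^sub>v v))\<^sup>2 = (vnorm v)\<^sup>2"
proof -
  define u where "u = P *\<^sub>v v"
  have u: "u \<in> carrier_vec n" using P v by (simp add: u_def)
  have "P *\<^sub>v u = u" unfolding u_def using P v by (metis assoc_mult_mat_vec)
  then have uv: "u \<bullet> v = u \<bullet> u"
    using scalar_prod_mult_transpose[OF P(1) v u] P(2) comm_scalar_prod[OF u v] by (simp add: u_def)
  have w: "(1\<^sub>m n - P) *\<^sub>v v = v - u"
    using P v by (subst minus_mult_distrib_mat_vec[of _ n n]) (auto simp: u_def)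
  have "(v - u) \<bullet> (v - u) = v \<bullet> v - u \<bullet> u"
    using u v uv comm_scalar_prod[OF u v]
    by (simp add: minus_scalar_prod_distrib[of _ n] scalar_prod_minus_distrib[of _ n])
  then show ?thesis by (simp add: vnorm_sq w flip: u_def)
qed

lemma frob_split_left:
  assumes P: "P \<in> carrier_mat n n" "transpose_mat P = P" "P * P = P" and N: "N \<in> carrier_mat n a"
  shows "(frob (P * N))\<^sup>2 + (frob ((1\<^sub>m n - P) * N))\<^sup>2 = (frob N)\<^sup>2"
proof -
  have "(frob (P * N))\<^sup>2 + (frob ((1\<^sub>m n - P) * N))\<^sup>2
      = (\<Sum>j<a. (vnorm (P *\<^sub>v col N j))\<^sup>2 + (vnorm ((1\<^sub>m n - P) *\<^sub>v col N j))\<^sup>2)"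
    using frob_mult_sq[OF P(1) N] frob_mult_sq[of "1\<^sub>m n - P" n n N a] P(1) N
    by (simp only: sum.distrib minus_carrier_mat)
  also have "\<dots> = (\<Sum>j<a. (vnorm (col N j))\<^sup>2)"
    using N by (intro sum.cong refl vnorm_split P) auto
  finally show ?thesis using N by (simp add: frob_sq_cols)
qed

lemma frob_split_right:
  assumes P: "P \<in> carrier_mat n n" "transpose_mat P = P" "P * P = P" and N: "N \<in> carrier_mat a n"
  shows "(frob (N * P))\<^sup>2 + (frob (N * (1\<^sub>m n - P)))\<^sup>2 = (frob N)\<^sup>2"
proof -
  have "transpose_mat (N * P) = P * transpose_mat N"
    using transpose_mult[OF N P(1)] P(2) by simp
  moreover have "transpose_mat (N * (1\<^sub>m n - P)) = (1\<^sub>m n - P) * transpose_mat N"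
    using transpose_mult[OF N, of "1\<^sub>m n - P" n] transpose_minus[of "1\<^sub>m n" n n P] P
    by (simp add: minus_carrier_mat)
  ultimately show ?thesis
    using frob_split_left[OF P, of "transpose_mat N" a] N by (metis frob_transpose transpose_carrier_mat)
qed

text \<open>\<open>P\<close> projects onto the first block of coordinates; \<open>G\<close> and \<open>H\<close> are square matrices whose only
  nonzero block is the lower left one, so that \<open>H - H\<^sup>T\<close> is \<open>X\<close> at the base point and \<open>G - G\<^sup>T\<close> is
  its variation.\<close>
locale cayley_blocks =
  fixes n :: nat and P G H C :: "real mat" and \<alpha> :: real
  assumes carrier [simp]: "P \<in> carrier_mat n n" "G \<in> carrier_mat n n" "H \<in> carrier_mat n n"
      "C \<in> carrier_mat n n"
    and P [simp]: "transpose_mat P = P" "P * P = P"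
    and blocks [simp]: "H * P = H" "P * H = 0\<^sub>m n n" "G * P = G" "P * G = 0\<^sub>m n n"
    and inverse: "(1\<^sub>m n - (H - transpose_mat H)) * C = 1\<^sub>m n"
    and \<alpha>: "0 \<le> \<alpha>"
    and H_le: "\<And>v. v \<in> carrier_vec n \<Longrightarrow> vnorm (H *\<^sub>v v) \<le> \<alpha> * vnorm v"
begin

abbreviation tr :: "real mat \<Rightarrow> real mat" where "tr \<equiv> transpose_mat"

definition X where "X = H - tr H"
definition \<Delta> where "\<Delta> = G - tr G"
definition N where "N = 1\<^sub>m n - X * X"
definition W where "W = tr C * (\<Delta> * C)"
definition V where "V = P * (W * (1\<^sub>m n - P))"

lemma sq_carrier [simp]: "(A :: real mat) \<in> carrier_mat n n \<Longrightarrow> B \<in> carrier_mat n n \<Longrightarrow> A * B \<in> carrier_mat n n"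
  by (rule mult_carrier_mat)

declare minus_carrier_mat [simp]

lemma carrier2 [simp]: "X \<in> carrier_mat n n" "\<Delta> \<in> carrier_mat n n" "N \<in> carrier_mat n n"
    "W \<in> carrier_mat n n" "V \<in> carrier_mat n n" "tr C \<in> carrier_mat n n"
  by (simp_all add: X_def \<Delta>_def N_def W_def V_def mult_carrier_mat[of _ n n])

lemma dims [simp]:
  "dim_row P = n" "dim_col P = n" "dim_row G = n" "dim_col G = n" "dim_row H = n" "dim_col H = n"
  "dim_row C = n" "dim_col C = n" "dim_row X = n" "dim_col X = n" "dim_row \<Delta> = n" "dim_col \<Delta> = n"
  "dim_row N = n" "dim_col N = n" "dim_row W = n" "dim_col W = n" "dim_row V = n" "dim_col V = n"
  using carrier carrier2 by (auto simp only: carrier_matD)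

lemma sq_vec_carrier [simp]: "A \<in> carrier_mat n n \<Longrightarrow> v \<in> carrier_vec n \<Longrightarrow> A *\<^sub>v v \<in> carrier_vec n"
  by (rule mult_mat_vec_carrier)

lemmas sq_assoc [simp] = assoc_mult_mat[of _ n n _ n _ n] assoc_mult_mat_vec[of _ n n _ n]

lemma minus_zero_sq [simp]: "A \<in> carrier_mat n n \<Longrightarrow> A - 0\<^sub>m n n = A" for A :: "real mat"
  by (rule eq_matI) auto

lemma zero_sq_vec [simp]: "v \<in> carrier_vec n \<Longrightarrow> 0\<^sub>m n n *\<^sub>v v = 0\<^sub>v n" for v :: "real vec"
  by (rule eq_vecI) auto

lemmas distrib = add_mult_distrib_mat[of _ n n _ _ n] mult_add_distrib_mat[of _ n n _ n]
  minus_mult_distrib_mat[of _ n n _ _ n] mult_minus_distrib_mat[of _ n n _ n]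

lemma transpose_sq: "A \<in> carrier_mat n n \<Longrightarrow> B \<in> carrier_mat n n \<Longrightarrow> tr (A * B) = tr B * tr A"
  by (rule transpose_mult)

lemma skew: "tr X = - X" "tr \<Delta> = - \<Delta>"
  by (rule eq_matI; simp add: X_def \<Delta>_def)+

text \<open>Block calculus without entries: if \<open>A = A P\<close> and \<open>P B = 0\<close>,
  then \<open>A B = A (P B) = 0\<close>. Two lower left blocks therefore multiply to zero, and so do
  two upper right ones.\<close>

lemma block_products [simp]:
  "P * tr H = tr H" "tr H * P = 0\<^sub>m n n" "P * tr G = tr G" "tr G * P = 0\<^sub>m n n"
  "H * H = 0\<^sub>m n n" "G * H = 0\<^sub>m n n" "H * G = 0\<^sub>m n n" "G * G = 0\<^sub>m n n"
  "tr H * tr H = 0\<^sub>m n n" "tr H * tr G = 0\<^sub>m n n" "tr G * tr H = 0\<^sub>m n n" "tr G * tr G = 0\<^sub>m n n"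
proof -
  show 1: "P * tr H = tr H" "P * tr G = tr G"
    using transpose_sq[of H P] transpose_sq[of G P] by (simp_all only: blocks P carrier)
  show 2: "tr H * P = 0\<^sub>m n n" using transpose_sq[of P H] by simp
  show 3: "tr G * P = 0\<^sub>m n n" using transpose_sq[of P G] by simp
  have "A * B = 0\<^sub>m n n" if "A * P = A" "P * B = 0\<^sub>m n n" "A \<in> carrier_mat n n" "B \<in> carrier_mat n n" for A B
    using that assoc_mult_mat[of A n n P n B n] by simp
  then show 4: "H * H = 0\<^sub>m n n" "G * H = 0\<^sub>m n n" "H * G = 0\<^sub>m n n" "G * G = 0\<^sub>m n n"
    by simp_all
  show "tr H * tr H = 0\<^sub>m n n" using transpose_sq[of H H] 4 by simp
  show "tr H * tr G = 0\<^sub>m n n" using transpose_sq[of G H] 4 by simp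
  show "tr G * tr H = 0\<^sub>m n n" using transpose_sq[of H G] 4 by simp
  show "tr G * tr G = 0\<^sub>m n n" using transpose_sq[of G G] 4 by simp
qed

text \<open>Skewness makes \<open>1 + X\<close> the transpose of \<open>1 - X\<close>, so
  \<open>tr C\<close> inverts it.\<close>

lemma inverse_eqs:
  "(1\<^sub>m n - X) * C = 1\<^sub>m n" "C * (1\<^sub>m n - X) = 1\<^sub>m n"
  "tr C * (1\<^sub>m n + X) = 1\<^sub>m n" "(1\<^sub>m n + X) * tr C = 1\<^sub>m n"
proof -
  show 1: "(1\<^sub>m n - X) * C = 1\<^sub>m n" using inverse by (simp add: X_def)
  show 2: "C * (1\<^sub>m n - X) = 1\<^sub>m n"
    using mat_mult_left_right_inverse[OF _ _ 1] by simp
  have "tr (1\<^sub>m n - X) = 1\<^sub>m n + X"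
    using skew(1) by (subst transpose_minus[of _ n n]) (auto intro!: eq_matI)
  then show "tr C * (1\<^sub>m n + X) = 1\<^sub>m n" "(1\<^sub>m n + X) * tr C = 1\<^sub>m n"
    using arg_cong[OF 1, of tr] arg_cong[OF 2, of tr] by (simp_all add: transpose_sq)
qed

lemma N_factor: "N = (1\<^sub>m n - X) * (1\<^sub>m n + X)" "N = (1\<^sub>m n + X) * (1\<^sub>m n - X)"
  by (simp_all add: N_def distrib) (rule eq_matI; simp)+

lemma X_sq: "X * X = 0\<^sub>m n n - (H * tr H + tr H * H)"
  by (simp add: X_def distrib) (rule eq_matI; simp)

text \<open>The square of \<open>X\<close> is block diagonal, since \<open>H H\<close> and
  \<open>tr H * tr H\<close> vanish.\<close>

lemma N_P: "N * P = P * N"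
proof -
  have "P * (H * tr H) = 0\<^sub>m n n" "P * (tr H * H) = tr H * H"
    using sq_assoc(1)[of P H "tr H"] sq_assoc(1)[of P "tr H" H] by (simp_all del: sq_assoc)
  then show ?thesis unfolding N_def X_sq by (simp add: distrib)
qed

text \<open>\<open>N\<close> commutes with \<open>P\<close>, so it can be moved next to the outer
  factors of \<open>W\<close>, where it removes the inverses: \<open>N * tr C = 1 - X\<close> and
  \<open>C * N = 1 + X\<close>. What remains is the polynomial
  \<open>P (1 - X) \<Delta> (1 + X) (1 - P)\<close>.\<close>

lemma NVN: "N * (V * N) = - (tr G + tr H * (G * tr H))"
proof -
  have 1: "N * (P * tr C) = P + tr H"
  proof -
    have "N * (P * tr C) = N * P * tr C" by simp
    also have "\<dots> = P * (N * tr C)" by (simp add: N_P)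
    also have "N * tr C = (1\<^sub>m n - X)"
      unfolding N_factor(1) by (simp add: inverse_eqs)
    also have "P * (1\<^sub>m n - X) = P + tr H"
      by (simp add: X_def distrib) (rule eq_matI; simp)
    finally show ?thesis .
  qed
  have 2: "C * ((1\<^sub>m n - P) * N) = 1\<^sub>m n - P - tr H"
  proof -
    have "(1\<^sub>m n - P) * N = N * (1\<^sub>m n - P)" by (simp add: distrib N_P)
    then have "C * ((1\<^sub>m n - P) * N) = C * N * (1\<^sub>m n - P)" by simp
    also have "C * N = C * (1\<^sub>m n - X) * (1\<^sub>m n + X)"
      unfolding N_factor(1) by simp
    also have "\<dots> = 1\<^sub>m n + X" unfolding inverse_eqs by simp
    also have "\<dots> * (1\<^sub>m n - P) = 1\<^sub>m n - P - tr H"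
      by (simp add: X_def distrib) (rule eq_matI; simp)
    finally show ?thesis .
  qed
  have "N * (V * N) = (N * (P * tr C)) * (\<Delta> * (C * ((1\<^sub>m n - P) * N)))"
    by (simp add: V_def W_def)
  also have "\<dots> = (P + tr H) * \<Delta> * (1\<^sub>m n - P - tr H)"
    unfolding 1 2 by simp
  also have "(P + tr H) * \<Delta> = tr H * G - tr G"
    by (simp add: \<Delta>_def distrib)
  also have "(tr H * G - tr G) * (1\<^sub>m n - P - tr H) = - (tr G + tr H * (G * tr H))"
    by (simp add: distrib) (rule eq_matI; simp)
  finally show ?thesis .
qed

text \<open>\<open>H\<close> sees only \<open>P v\<close>, its transpose only
  \<open>(1 - P) v\<close>, and their images are orthogonal; hence the bound is \<alpha> and not the
  \<alpha> + \<alpha> of the triangle inequality.\<close>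

lemma X_le: assumes v: "v \<in> carrier_vec n" shows "vnorm (X *\<^sub>v v) \<le> \<alpha> * vnorm v"
proof (rule power2_le_imp_le)
  have split: "(vnorm (P *\<^sub>v v))\<^sup>2 + (vnorm ((1\<^sub>m n - P) *\<^sub>v v))\<^sup>2 = (vnorm v)\<^sup>2"
    using v by (intro vnorm_split) simp_all
  have 1: "vnorm (H *\<^sub>v v) \<le> \<alpha> * vnorm (P *\<^sub>v v)"
    using H_le[of "P *\<^sub>v v"] v assoc_mult_mat_vec[of H n n P n v] by (simp del: assoc_mult_mat_vec sq_assoc)
  have 2: "vnorm (tr H *\<^sub>v v) \<le> \<alpha> * vnorm ((1\<^sub>m n - P) *\<^sub>v v)"
  proof -
    have "tr H *\<^sub>v v = (tr H * (1\<^sub>m n - P)) *\<^sub>v v" by (simp add: distrib del: assoc_mult_mat_vec sq_assoc)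
    also have "\<dots> = tr H *\<^sub>v ((1\<^sub>m n - P) *\<^sub>v v)" using v by simp
    finally show ?thesis
      using vnorm_transpose_mult_le[OF carrier(3) _ \<alpha> H_le, of "(1\<^sub>m n - P) *\<^sub>v v"] v
      by (simp add: mult_mat_vec_carrier[of _ n n])
  qed
  have "tr H *\<^sub>v (tr H *\<^sub>v v) = (tr H * tr H) *\<^sub>v v" using v by (simp del: block_products)
  also have "\<dots> = 0\<^sub>v n" using v by simp
  finally have orth: "(H *\<^sub>v v) \<bullet> (tr H *\<^sub>v v) = 0"
    using scalar_prod_mult_transpose[OF carrier(3) v, of "tr H *\<^sub>v v"] v by simp
  have "X *\<^sub>v v = H *\<^sub>v v - tr H *\<^sub>v v"
    unfolding X_def using v by (subst minus_mult_distrib_mat_vec[of _ n n]) auto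
  then have "(vnorm (X *\<^sub>v v))\<^sup>2 = (vnorm (H *\<^sub>v v))\<^sup>2 + (vnorm (tr H *\<^sub>v v))\<^sup>2"
    using v orth comm_scalar_prod[of "H *\<^sub>v v" n "tr H *\<^sub>v v"]
    by (simp add: vnorm_sq minus_scalar_prod_distrib[of _ n] scalar_prod_minus_distrib[of _ n]
        mult_mat_vec_carrier[of _ n n])
  also have "\<dots> \<le> (\<alpha> * vnorm (P *\<^sub>v v))\<^sup>2 + (\<alpha> * vnorm ((1\<^sub>m n - P) *\<^sub>v v))\<^sup>2"
    using 1 2 by (intro add_mono power_mono) auto
  also have "\<dots> = (\<alpha> * vnorm v)\<^sup>2"
    unfolding split[symmetric] power_mult_distrib by (simp add: algebra_simps)
  finally show "(vnorm (X *\<^sub>v v))\<^sup>2 \<le> (\<alpha> * vnorm v)\<^sup>2" .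
qed (use \<alpha> in simp)

lemma N_le: assumes v: "v \<in> carrier_vec n" shows "vnorm (N *\<^sub>v v) \<le> (1 + \<alpha>\<^sup>2) * vnorm v"
proof -
  have Xv: "X *\<^sub>v v \<in> carrier_vec n" using v by (simp add: mult_mat_vec_carrier[of _ n n])
  have "N *\<^sub>v v = v + (-1) \<cdot>\<^sub>v (X *\<^sub>v (X *\<^sub>v v))"
    unfolding N_def using v by (subst minus_mult_distrib_mat_vec[of _ n n]) (auto intro!: eq_vecI)
  then have "vnorm (N *\<^sub>v v) \<le> vnorm v + vnorm (X *\<^sub>v (X *\<^sub>v v))"
    using vnorm_triangle[of v n "(-1) \<cdot>\<^sub>v (X *\<^sub>v (X *\<^sub>v v))"] v Xv
    by (simp add: vnorm_smult mult_mat_vec_carrier[of _ n n])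
  also have "vnorm (X *\<^sub>v (X *\<^sub>v v)) \<le> \<alpha> * (\<alpha> * vnorm v)"
    using X_le[OF Xv] mult_left_mono[OF X_le[OF v] \<alpha>] by linarith
  finally show ?thesis by (simp add: power2_eq_square algebra_simps)
qed

text \<open>For \<open>w = C v\<close> skewness gives \<open>w \<bullet> X w = 0\<close>, so
  \<open>|v|^2 = |w - X w|^2 = |w|^2 + |X w|^2\<close>.\<close>

lemma C_le: assumes v: "v \<in> carrier_vec n" shows "vnorm (C *\<^sub>v v) \<le> vnorm v"
proof (rule power2_le_imp_le)
  define w where "w = C *\<^sub>v v"
  have w: "w \<in> carrier_vec n" "X *\<^sub>v w \<in> carrier_vec n"
    using v by (auto simp: w_def mult_mat_vec_carrier[of _ n n])
  have "v = ((1\<^sub>m n - X) * C) *\<^sub>v v" using v by (simp add: inverse_eqs del: assoc_mult_mat_vec sq_assoc)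
  also have "\<dots> = (1\<^sub>m n - X) *\<^sub>v w" using v by (simp add: w_def)
  also have "\<dots> = w - X *\<^sub>v w" using w by (subst minus_mult_distrib_mat_vec[of _ n n]) auto
  finally have v_eq: "v = w - X *\<^sub>v w" .
  have "(X *\<^sub>v w) \<bullet> w = w \<bullet> (tr X *\<^sub>v w)" using w by (intro scalar_prod_mult_transpose) auto
  also have "tr X *\<^sub>v w = - (X *\<^sub>v w)" using w by (simp add: skew)
  finally have "w \<bullet> (X *\<^sub>v w) = 0" using w comm_scalar_prod[OF w] by simp
  then have "(vnorm v)\<^sup>2 = (vnorm w)\<^sup>2 + (vnorm (X *\<^sub>v w))\<^sup>2"
    unfolding v_eq using w comm_scalar_prod[OF w]
    by (simp add: vnorm_sq minus_scalar_prod_distrib[of _ n] scalar_prod_minus_distrib[of _ n])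
  then show "(vnorm (C *\<^sub>v v))\<^sup>2 \<le> (vnorm v)\<^sup>2" by (simp add: w_def)
qed simp

text \<open>The factor 2 counts the two nonzero blocks \<open>G\<close> and \<open>- tr G\<close> of
  \<Delta>; multiplication by the contractions \<open>C\<close> and \<open>tr C\<close> costs
  nothing.\<close>

lemma frob_W_le: "(frob W)\<^sup>2 \<le> 2 * (frob G)\<^sup>2"
proof -
  have "frob (\<Delta> * C) \<le> 1 * frob \<Delta>"
    using C_le by (intro frob_mult_right_le[of _ n n _ n]) auto
  moreover have "frob (tr C * (\<Delta> * C)) \<le> 1 * frob (\<Delta> * C)"
    using vnorm_transpose_mult_le[OF carrier(4), of _ 1] C_le
    by (intro frob_mult_le[of _ n n _ n]) auto
  ultimately have "frob W \<le> frob \<Delta>" by (simp add: W_def)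
  moreover have "(frob \<Delta>)\<^sup>2 = 2 * (frob G)\<^sup>2"
  proof -
    have "P * \<Delta> = - tr G" "(1\<^sub>m n - P) * \<Delta> = G"
      by (simp_all add: \<Delta>_def distrib) (rule eq_matI; simp)+
    then show ?thesis using frob_split_left[of P n \<Delta> n] by simp
  qed
  ultimately show ?thesis using power_mono[of "frob W" "frob \<Delta>" 2] by simp
qed

lemma frob_NV_le: "frob (N * Y) \<le> (1 + \<alpha>\<^sup>2) * frob Y" "frob (Y * N) \<le> (1 + \<alpha>\<^sup>2) * frob Y"
  if "Y \<in> carrier_mat n n"
  using N_le that by (auto intro!: frob_mult_le[of _ n n _ n] frob_mult_right_le[of _ n n _ n])

lemma frob_G_le: "(1 - \<alpha>\<^sup>2) * frob G \<le> (1 + \<alpha>\<^sup>2)\<^sup>2 * frob V"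
proof -
  \<comment> \<open>The part of \<open>- N V N\<close> that may cancel \<open>tr G\<close>. Its two
    factors \<open>tr H\<close> bound it by \<open>\<alpha>^2 * frob G\<close>, so the resulting
    estimate is informative only for \<alpha> < 1.\<close>
  define R where "R = tr H * (G * tr H)"
  have R: "R \<in> carrier_mat n n" by (simp add: R_def)
  have le: "vnorm (tr H *\<^sub>v v) \<le> \<alpha> * vnorm v" if "v \<in> carrier_vec n" for v
    using vnorm_transpose_mult_le[OF carrier(3) that \<alpha> H_le] .
  have "frob R \<le> \<alpha> * frob (G * tr H)"
    unfolding R_def using le \<alpha> by (intro frob_mult_le[of _ n n _ n]) auto
  also have "\<dots> \<le> \<alpha> * (\<alpha> * frob G)"
    using le \<alpha> by (intro mult_left_mono frob_mult_right_le[of _ n n _ n]) auto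
  finally have "frob R \<le> \<alpha>\<^sup>2 * frob G" by (simp add: power2_eq_square)
  moreover have "tr G = (tr G + R) + - R" using R by (intro eq_matI) auto
  then have "frob G \<le> frob (tr G + R) + frob R"
    using frob_triangle[of "tr G + R" n n "- R"] R by (metis add_carrier_mat carrier(2) frob_transpose
      frob_uminus transpose_carrier_mat uminus_carrier_iff_mat)
  moreover have "frob (tr G + R) = frob (N * (V * N))" by (simp add: NVN R_def)
  moreover have "frob (N * (V * N)) \<le> (1 + \<alpha>\<^sup>2)\<^sup>2 * frob V"
  proof -
    have "frob (N * (V * N)) \<le> (1 + \<alpha>\<^sup>2) * frob (V * N)" by (intro frob_NV_le) simp
    also have "\<dots> \<le> (1 + \<alpha>\<^sup>2) * ((1 + \<alpha>\<^sup>2) * frob V)"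
      by (intro mult_left_mono frob_NV_le) auto
    finally show ?thesis by (simp add: power2_eq_square mult.assoc)
  qed
  ultimately show ?thesis by (simp add: algebra_simps)
qed

text \<open>Under the symmetry hypothesis \<open>tr H * G * tr H\<close> equals
  \<open>tr G * H * tr H\<close>, so \<open>tr G\<close> and the perturbation together are exactly
  \<open>tr G * N\<close>. Cancelling the invertible \<open>N\<close> on the right leaves
  \<open>N V = - tr G\<close>, with no loss of a factor 1 - \<alpha>^2.\<close>

lemma frob_G_le_sym:
  assumes sym: "tr (tr H * G) = tr H * G"
  shows "frob G \<le> (1 + \<alpha>\<^sup>2) * frob V"
proof -
  have HG: "tr H * G = tr G * H" using sym by (simp add: transpose_sq)
  have "tr H * (G * tr H) = tr G * (H * tr H)"
    using HG assoc_mult_mat[of "tr H" n n G n "tr H" n] assoc_mult_mat[of "tr G" n n H n "tr H" n] by simp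
  moreover have "tr G * N = tr G + tr G * (H * tr H)"
    using zero_mult_assoc[OF block_products(11), where Y = H and d = n and b = n]
    unfolding N_def X_sq by (simp add: distrib) (rule eq_matI; simp)
  ultimately have eq: "N * (V * N) = - (tr G * N)" using NVN by simp
  have inv: "N * (C * tr C) = 1\<^sub>m n"
  proof -
    have "N * (C * tr C) = (1\<^sub>m n + X) * (((1\<^sub>m n - X) * C) * tr C)"
      unfolding N_factor(2) by simp
    then show ?thesis by (simp add: inverse_eqs)
  qed
  have "N * V = N * V * (N * (C * tr C))" by (simp add: inv)
  also have "\<dots> = (N * (V * N)) * (C * tr C)" by simp
  also have "\<dots> = - (tr G * N * (C * tr C))" unfolding eq by simp
  also have "tr G * N * (C * tr C) = tr G * (N * (C * tr C))" by simp
  finally have "N * V = - tr G" by (simp add: inv)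
  then have "frob G = frob (N * V)" by simp
  then show ?thesis using frob_NV_le(1)[of V] by simp
qed

text \<open>Orthogonality of the Cayley transform comes from \<open>1 + X\<close> and
  \<open>1 - X\<close> commuting. The second identity is what produces the congruence
  \<open>W\<close> in the rotated increment.\<close>

lemma Q_facts:
  "tr ((1\<^sub>m n + X) * C) * ((1\<^sub>m n + X) * C) = 1\<^sub>m n" "tr C * ((1\<^sub>m n + X) * C) = C"
proof -
  show CQ: "tr C * ((1\<^sub>m n + X) * C) = C"
    using assoc_mult_mat[of "tr C" n n "1\<^sub>m n + X" n C n] by (simp add: inverse_eqs)
  have "tr ((1\<^sub>m n + X) * C) = tr C * (1\<^sub>m n - X)"
    using skew(1) transpose_add[of "1\<^sub>m n" n n X] by (simp add: transpose_sq)
       (intro arg_cong2[of _ _ _ _ "(*)"] refl eq_matI; simp)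
  then have "tr ((1\<^sub>m n + X) * C) * ((1\<^sub>m n + X) * C) = tr C * ((1\<^sub>m n - X) * (1\<^sub>m n + X)) * C"
    by (simp add: minus_carrier_mat)
  also have "(1\<^sub>m n - X) * (1\<^sub>m n + X) = (1\<^sub>m n + X) * (1\<^sub>m n - X)" using N_factor by simp
  also have "tr C * ((1\<^sub>m n + X) * (1\<^sub>m n - X)) * C = (tr C * (1\<^sub>m n + X)) * ((1\<^sub>m n - X) * C)"
    by (simp add: minus_carrier_mat)
  finally show "tr ((1\<^sub>m n + X) * C) * ((1\<^sub>m n + X) * C) = 1\<^sub>m n" by (simp add: inverse_eqs)
qed

end

text \<open>\<open>x\<close> and \<open>y\<close> are the norms of the rotated increment times
  \<open>P\<close> and times \<open>1 - P\<close>. The second product no longer contains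
  \<open>m\<close>, since \<open>tr E * (1 - P) = 0\<close>, and equals \<open>-2 M Y\<close> with
  \<open>E * Y = V\<close>; here the lower bound \<sigma> on \<open>M\<close> applies. In the first,
  \<open>m\<close> is recovered by the triangle inequality.\<close>

lemma (in cayley_blocks) tangent_lower_bound:
  assumes E: "E \<in> carrier_mat n r" "transpose_mat E * E = 1\<^sub>m r" "P = E * transpose_mat E"
    and M: "M \<in> carrier_mat p r" and m: "m \<in> carrier_mat p r"
    and upper: "\<And>v. v \<in> carrier_vec r \<Longrightarrow> vnorm (M *\<^sub>v v) \<le> \<mu> * vnorm v" and \<mu>: "0 \<le> \<mu>"
    and lower: "\<And>v. v \<in> carrier_vec r \<Longrightarrow> \<sigma> * vnorm v \<le> vnorm (M *\<^sub>v v)" and \<sigma>: "0 \<le> \<sigma>"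
  obtains x y where "(frob (m * tr E - 2 \<cdot>\<^sub>m (M * (tr E * W))))\<^sup>2 = x\<^sup>2 + y\<^sup>2" "0 \<le> x"
    "frob m \<le> x + 2 * \<mu> * frob W" "2 * \<sigma> * frob V \<le> y"
proof -
  have tE: "tr E \<in> carrier_mat r n" using E by simp
  have tE_le: "vnorm (tr E *\<^sub>v v) \<le> 1 * vnorm v" if "v \<in> carrier_vec n" for v
    using vnorm_transpose_mult_le[OF E(1) that, of 1] vnorm_mult_isometry[OF E(1,2)] by simp
  define T where "T = m * tr E - 2 \<cdot>\<^sub>m (M * (tr E * W))"
  have T: "T \<in> carrier_mat p n" using m M tE mult_carrier_mat[OF M] mult_carrier_mat[OF tE, of W n]
    by (simp add: T_def)
  have EP: "tr E * P = tr E"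
    unfolding E(3) using E tE assoc_mult_mat[OF tE E(1) tE] by simp
  define Z where "Z = tr E * (W * P)"
  define Y where "Y = tr E * (W * (1\<^sub>m n - P))"
  have Z: "Z \<in> carrier_mat r n" and Y: "Y \<in> carrier_mat r n"
    unfolding Z_def Y_def by (rule mult_carrier_mat[OF tE], simp)+
  have expand: "T * R = m * (tr E * R) - 2 \<cdot>\<^sub>m (M * (tr E * (W * R)))"
    if R: "R \<in> carrier_mat n n" for R
  proof -
    have 1: "m * tr E \<in> carrier_mat p n" using m tE by (rule mult_carrier_mat)
    have 2: "tr E * W \<in> carrier_mat r n" by (rule mult_carrier_mat[OF tE]) simp
    have 3: "M * (tr E * W) \<in> carrier_mat p n" using M 2 by (rule mult_carrier_mat)
    have "T * R = m * tr E * R - (2 \<cdot>\<^sub>m (M * (tr E * W))) * R"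
      unfolding T_def using 1 3 R by (intro minus_mult_distrib_mat) auto
    also have "(2 \<cdot>\<^sub>m (M * (tr E * W))) * R = 2 \<cdot>\<^sub>m (M * (tr E * W) * R)"
      using 3 R by (rule mult_smult_assoc_mat)
    also have "M * (tr E * W) * R = M * (tr E * W * R)" by (rule assoc_mult_mat[OF M 2 R])
    also have "tr E * W * R = tr E * (W * R)" using tE R by (intro assoc_mult_mat) auto
    also have "m * tr E * R = m * (tr E * R)" by (rule assoc_mult_mat[OF m tE R])
    finally show ?thesis .
  qed
  have MZ: "M * Z \<in> carrier_mat p n" and MY: "M * Y \<in> carrier_mat p n"
    using M Z Y by (auto intro: mult_carrier_mat)
  have TP: "T * P = m * tr E - 2 \<cdot>\<^sub>m (M * Z)" using expand[of P] EP by (simp add: Z_def)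
  have TP': "T * (1\<^sub>m n - P) = - (2 \<cdot>\<^sub>m (M * Y))"
  proof -
    have "tr E * (1\<^sub>m n - P) = tr E - tr E"
      using tE EP by (subst mult_minus_distrib_mat[of _ r n _ n]) auto
    then have "tr E * (1\<^sub>m n - P) = 0\<^sub>m r n" using tE by simp
    then show ?thesis using expand[of "1\<^sub>m n - P"] m M Y
      by (intro eq_matI) (auto simp: Y_def[symmetric] simp del: index_mult_mat(1))
  qed
  have split: "(frob T)\<^sup>2 = (frob (T * P))\<^sup>2 + (frob (T * (1\<^sub>m n - P)))\<^sup>2"
    using frob_split_right[of P n T p] T by simp
  have "frob m = frob (m * tr E)"
    using frob_mult_isometry[OF E(1) _ E(2), of "tr m" p] m transpose_mult[OF m tE]
    by (metis frob_transpose transpose_carrier_mat transpose_transpose)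
  also have "m * tr E = T * P + 2 \<cdot>\<^sub>m (M * Z)"
    unfolding TP using m tE MZ by (intro eq_matI) auto
  also have "frob \<dots> \<le> frob (T * P) + frob (2 \<cdot>\<^sub>m (M * Z))"
    using T MZ by (intro frob_triangle[of _ p n]) (auto intro: mult_carrier_mat)
  also have "frob (2 \<cdot>\<^sub>m (M * Z)) = 2 * frob (M * Z)" by (simp add: frob_smult)
  also have "frob (M * Z) \<le> \<mu> * frob Z" using frob_mult_le[OF M Z \<mu> upper] .
  also have "frob Z \<le> frob (W * P)"
    using frob_mult_le[OF tE, of "W * P" n 1] tE_le by (simp add: Z_def)
  also have "frob (W * P) \<le> frob W"
  proof (rule power2_le_imp_le)
    have "(frob (W * P))\<^sup>2 + (frob (W * (1\<^sub>m n - P)))\<^sup>2 = (frob W)\<^sup>2"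
      by (rule frob_split_right[where a = n]) simp_all
    then show "(frob (W * P))\<^sup>2 \<le> (frob W)\<^sup>2"
      using zero_le_power2[of "frob (W * (1\<^sub>m n - P))"] by linarith
  qed simp
  finally have x: "frob m \<le> frob (T * P) + 2 * \<mu> * frob W"
    using \<mu> by (simp add: mult_left_mono)
  have "frob V = frob (E * Y)"
    using assoc_mult_mat[OF E(1) tE, of "W * (1\<^sub>m n - P)" n]
    by (simp add: V_def Y_def flip: E(3))
  also have "\<dots> = frob Y" by (rule frob_mult_isometry[OF E(1) Y E(2)])
  finally have "\<sigma> * frob V \<le> frob (M * Y)" using frob_mult_ge[OF M Y \<sigma> lower] by simp
  then have y: "2 * \<sigma> * frob V \<le> frob (T * (1\<^sub>m n - P))"
    unfolding TP' by (simp add: frob_smult)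
  show thesis using that[of "frob (T * P)" "frob (T * (1\<^sub>m n - P))"] split x y by (simp add: T_def)
qed

text \<open>Here \<open>b\<close> and \<open>m\<close> stand for the norms of the two parameter
  increments; the bound on \<open>b\<close> depends on \<open>y\<close> only and is fed into the one
  for \<open>m\<close>.\<close>

lemma tangent_bound_arith:
  fixes x y v w b m \<kappa> \<sigma> \<mu> :: real
  assumes pos: "0 < \<sigma>" "0 < \<kappa>" "0 \<le> \<mu>" "0 \<le> m" "0 \<le> b" "0 \<le> w" "0 \<le> x"
    and v: "\<kappa> * b \<le> v" and y: "2 * \<sigma> * v \<le> y" and w: "w\<^sup>2 \<le> 2 * b\<^sup>2" and m: "m \<le> x + 2 * \<mu> * w"
  shows "m\<^sup>2 + b\<^sup>2 \<le> (1 + (1 + 8 * \<mu>\<^sup>2) / (4 * \<sigma>\<^sup>2 * \<kappa>\<^sup>2)) * (x\<^sup>2 + y\<^sup>2)"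
proof -
  define s where "s = 4 * \<sigma>\<^sup>2 * \<kappa>\<^sup>2"
  \<comment> \<open>The 8 is 4 from squaring \<open>2 * \<mu> * w\<close> times 2 from the bound on
    \<open>w^2\<close>.\<close>
  define \<tau> where "\<tau> = 8 * \<mu>\<^sup>2 / s"
  have s: "0 < s" using pos by (simp add: s_def)
  have \<tau>: "0 \<le> \<tau>" using s by (simp add: \<tau>_def)
  have "2 * \<sigma> * (\<kappa> * b) \<le> y" using v y pos by (smt (verit) mult_left_mono)
  then have "(2 * \<sigma> * (\<kappa> * b))\<^sup>2 \<le> y\<^sup>2" using pos by (intro power_mono) auto
  then have sb: "b\<^sup>2 \<le> y\<^sup>2 / s" using s by (simp add: s_def power_mult_distrib field_simps)
  have "(2 * \<mu> * w)\<^sup>2 = 4 * \<mu>\<^sup>2 * w\<^sup>2" by (simp add: power_mult_distrib)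
  also have "\<dots> \<le> 4 * \<mu>\<^sup>2 * (2 * (y\<^sup>2 / s))" using w sb by (intro mult_left_mono) auto
  finally have u: "(2 * \<mu> * w)\<^sup>2 \<le> \<tau> * y\<^sup>2" by (simp add: \<tau>_def)
  have "2 * \<mu> * w \<le> sqrt \<tau> * \<bar>y\<bar>"
    using real_le_rsqrt[OF u] by (simp add: real_sqrt_mult)
  then have "m \<le> x + sqrt \<tau> * \<bar>y\<bar>" using m by linarith
  then have "m\<^sup>2 \<le> (x + sqrt \<tau> * \<bar>y\<bar>)\<^sup>2" using pos by (intro power_mono) auto
  \<comment> \<open>Cauchy-Schwarz for \<open>(1, sqrt \<tau>)\<close> and \<open>(x, |y|)\<close>;
    the two sides differ by the square of \<open>sqrt \<tau> * x - |y|\<close>.\<close>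
  also have "\<dots> \<le> (1 + (sqrt \<tau>)\<^sup>2) * (x\<^sup>2 + \<bar>y\<bar>\<^sup>2)"
    using zero_le_power2[of "sqrt \<tau> * x - \<bar>y\<bar>"] by (simp add: power2_eq_square algebra_simps)
  finally have "m\<^sup>2 \<le> (1 + \<tau>) * (x\<^sup>2 + y\<^sup>2)" using \<tau> by simp
  moreover have "b\<^sup>2 \<le> (x\<^sup>2 + y\<^sup>2) / s" using sb s by (smt (verit) divide_right_mono zero_le_power2)
  ultimately show ?thesis
    by (simp add: \<tau>_def add_divide_distrib distrib_right flip: s_def)
qed

text \<open>Right multiplication by the orthogonal \<open>Q\<close> preserves the Frobenius norm. It
  takes \<open>tr (Q * E)\<close> to \<open>tr E\<close>, and \<open>tr C * Q = C\<close> takes the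
  transposed derivative to \<open>-2 * tr E * W\<close>.\<close>

lemma (in cayley_blocks) rotate_tangent:
  assumes E: "E \<in> carrier_mat n r" and M: "M \<in> carrier_mat p r" and m: "m \<in> carrier_mat p r"
  defines "Q \<equiv> (1\<^sub>m n + X) * C"
  shows "frob (m * tr (Q * E) + M * tr (2 \<cdot>\<^sub>m (C * (\<Delta> * (C * E)))))
       = frob (m * tr E - 2 \<cdot>\<^sub>m (M * (tr E * W)))"
proof -
  have Q: "Q \<in> carrier_mat n n" by (simp add: Q_def)
  have tE: "tr E \<in> carrier_mat r n" using E by simp
  define N0 where "N0 = m * tr (Q * E) + M * tr (2 \<cdot>\<^sub>m (C * (\<Delta> * (C * E))))"
  have QQ: "tr Q * Q = 1\<^sub>m n" and CQ: "tr C * Q = C" using Q_facts by (simp_all add: Q_def)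
  have QQ': "Q * tr Q = 1\<^sub>m n" using mat_mult_left_right_inverse[OF _ Q QQ] Q by simp
  have 1: "tr (Q * E) = tr E * tr Q" by (rule transpose_mult[OF Q E])
  have CDC: "C * (\<Delta> * (C * E)) = (C * (\<Delta> * C)) * E"
    using E assoc_mult_mat[of C n n "\<Delta> * C" n E r] assoc_mult_mat[of \<Delta> n n C n E r] by simp
  \<comment> \<open>The minus sign is the skewness of \<Delta>.\<close>
  have 2: "tr (2 \<cdot>\<^sub>m (C * (\<Delta> * (C * E)))) = (-2) \<cdot>\<^sub>m (tr E * (tr C * (\<Delta> * tr C)))"
  proof -
    have "tr (2 \<cdot>\<^sub>m (C * (\<Delta> * (C * E)))) = 2 \<cdot>\<^sub>m tr ((C * (\<Delta> * C)) * E)"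
      unfolding CDC by (intro eq_matI) auto
    also have "tr ((C * (\<Delta> * C)) * E) = tr E * - (tr C * (\<Delta> * tr C))"
      using E by (subst transpose_mult[of _ n n _ r]) (auto simp: transpose_sq skew)
    also have "\<dots> = - (tr E * (tr C * (\<Delta> * tr C)))" using E by simp
    finally show ?thesis by (auto intro!: eq_matI)
  qed
  define L where "L = tr E * (tr C * (\<Delta> * tr C))"
  have L: "L \<in> carrier_mat r n" unfolding L_def by (rule mult_carrier_mat[OF tE]) simp
  have LQ: "L * Q = tr E * W"
    unfolding L_def W_def using tE Q CQ assoc_mult_mat[of "tr E" r n "tr C * (\<Delta> * tr C)" n Q n] by simp
  have mE: "m * (tr E * tr Q) \<in> carrier_mat p n" and cML: "M * L \<in> carrier_mat p n"
    using m M tE Q L by (auto intro!: mult_carrier_mat)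
  have N0: "N0 = m * (tr E * tr Q) - 2 \<cdot>\<^sub>m (M * L)"
    unfolding N0_def 1 2 L_def[symmetric] using mE cML mult_smult_distrib[OF M L, of "-2"]
    by (intro eq_matI) auto
  have N0c: "N0 \<in> carrier_mat p n" unfolding N0 using mE cML by simp
  have "N0 * Q = m * (tr E * tr Q) * Q - (2 \<cdot>\<^sub>m (M * L)) * Q"
    unfolding N0 using mE cML Q by (intro minus_mult_distrib_mat) auto
  also have "(2 \<cdot>\<^sub>m (M * L)) * Q = 2 \<cdot>\<^sub>m (M * L * Q)" using cML Q by (rule mult_smult_assoc_mat)
  also have "M * L * Q = M * (tr E * W)" using assoc_mult_mat[OF M L Q] LQ by simp
  also have "m * (tr E * tr Q) * Q = m * (tr E * (tr Q * Q))"
    using m tE Q assoc_mult_mat[of m p r "tr E * tr Q" n Q n] assoc_mult_mat[of "tr E" r n "tr Q" n Q n]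
    by simp
  also have "\<dots> = m * tr E" using tE QQ by simp
  finally have eq: "N0 * Q = m * tr E - 2 \<cdot>\<^sub>m (M * (tr E * W))" .
  have "frob (N0 * Q) = frob (tr Q * tr N0)"
    using transpose_mult[OF N0c Q] by (metis frob_transpose)
  also have "\<dots> = frob N0"
    using frob_mult_isometry[of "tr Q" n n "tr N0" p] Q QQ' N0c by simp
  finally show ?thesis using eq by (simp add: N0_def)
qed

section \<open>Stacked parameter vectors and the inverse of identity minus skew\<close>

lemma mvec_surj:
  assumes "v \<in> carrier_vec (a * b)"
  obtains N where "N \<in> carrier_mat a b" "mvec N = v"
proof
  show "mat a b (\<lambda>(i, j). v $ (i + a * j)) \<in> carrier_mat a b" by simp
  show "mvec (mat a b (\<lambda>(i, j). v $ (i + a * j))) = v"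
    using assms by (intro eq_vecI) (auto simp: mvec_index div_mod_bounds)
qed

lemma hcat_mult_append:
  assumes B: "B \<in> carrier_mat a b" and C: "C \<in> carrier_mat a c"
    and u: "u \<in> carrier_vec b" and w: "w \<in> carrier_vec c"
  shows "hcat B C *\<^sub>v (u @\<^sub>v w) = B *\<^sub>v u + C *\<^sub>v w"
proof (rule eq_vecI)
  fix i assume "i < dim_vec (B *\<^sub>v u + C *\<^sub>v w)"
  then have i: "i < a" using C by simp
  have "row (hcat B C) i = row B i @\<^sub>v row C i"
    using i B C by (intro eq_vecI) (auto simp: hcat_def)
  then show "(hcat B C *\<^sub>v (u @\<^sub>v w)) $ i = (B *\<^sub>v u + C *\<^sub>v w) $ i"
    using i B C u w scalar_prod_append[of "row B i" b "row C i" c u w]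
    by (simp add: hcat_def)
qed (use B C in \<open>simp add: hcat_def\<close>)

lemma vnorm_append_sq: "(vnorm (u @\<^sub>v w))\<^sup>2 = (vnorm u)\<^sup>2 + (vnorm w)\<^sup>2"
  unfolding vnorm_sq
  by (rule scalar_prod_append[OF carrier_vec_dim_vec carrier_vec_dim_vec carrier_vec_dim_vec carrier_vec_dim_vec])

lemma kron_carrier: "kron A B \<in> carrier_mat (dim_row A * dim_row B) (dim_col A * dim_col B)"
  by (simp add: kron_def)

text \<open>If \<open>v = S v\<close>, then \<open>|v|^2 = v \<bullet> S v = 0\<close> by skewness.
  Thus \<open>minv\<close> is a genuine inverse here and not its default value, the zero
  matrix.\<close>

lemma skew_minv:
  assumes S: "(S :: real mat) \<in> carrier_mat n n" and skew: "transpose_mat S = - S"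
  shows "minv (1\<^sub>m n - S) \<in> carrier_mat n n" "(1\<^sub>m n - S) * minv (1\<^sub>m n - S) = 1\<^sub>m n"
proof -
  have IS: "1\<^sub>m n - S \<in> carrier_mat n n" using S by (simp add: minus_carrier_mat)
  have "v = 0\<^sub>v n" if v: "v \<in> carrier_vec n" "(1\<^sub>m n - S) *\<^sub>v v = 0\<^sub>v n" for v
  proof -
    have Sv: "S *\<^sub>v v \<in> carrier_vec n" using S v by simp
    have "v - S *\<^sub>v v = 0\<^sub>v n"
      unfolding v(2)[symmetric] using S v(1) by (subst minus_mult_distrib_mat_vec[of _ n n]) auto
    then have "v \<bullet> (v - S *\<^sub>v v) = 0" using v(1) by simp
    moreover have "(S *\<^sub>v v) \<bullet> v = - (v \<bullet> (S *\<^sub>v v))"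
      using scalar_prod_mult_transpose[OF S v(1) v(1)] S v(1) skew by simp
    ultimately have "(vnorm v)\<^sup>2 = 0"
      using comm_scalar_prod[OF Sv v(1)] v Sv by (simp add: scalar_prod_minus_distrib[of _ n] vnorm_sq)
    then show ?thesis using vnorm_sq_eq_0_iff v by blast
  qed
  then obtain B where "B \<in> carrier_mat n n" "(1\<^sub>m n - S) * B = 1\<^sub>m n"
    using injective_mat_inverse[OF IS] by metis
  then show "minv (1\<^sub>m n - S) \<in> carrier_mat n n" "(1\<^sub>m n - S) * minv (1\<^sub>m n - S) = 1\<^sub>m n"
    using minv_eqI[OF IS] by auto
qed

section \<open>The Jacobian of the parameterization\<close>

lemma Ipr_carrier [simp]: "Ipr n r \<in> carrier_mat n r"
  by (simp add: Ipr_def)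

lemma Theta2_carrier [simp]: "Theta2 n r \<in> carrier_mat (n - r) n"
  by (simp add: Theta2_def)

lemma Ipr_Theta2_dims [simp]:
  "dim_row (Ipr n r) = n" "dim_col (Ipr n r) = r" "dim_row (Theta2 n r) = n - r" "dim_col (Theta2 n r) = n"
  by (simp_all add: Ipr_def Theta2_def)

lemma smult_mat_mult_vec:
  assumes "(A :: real mat) \<in> carrier_mat a b" "v \<in> carrier_vec b"
  shows "(c \<cdot>\<^sub>m A) *\<^sub>v v = c \<cdot>\<^sub>v (A *\<^sub>v v)"
  using assms by (intro eq_vecI) auto

lemma mvec_carrier: "N \<in> carrier_mat a b \<Longrightarrow> mvec N \<in> carrier_vec (a * b)"
  by (auto intro!: carrier_vecI)

lemma Kcomm_dims [simp]: "dim_row (Kcomm p q) = p * q" "dim_col (Kcomm p q) = p * q"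
  by (simp_all add: Kcomm_def)

lemma Kcomm_carrier [simp]: "Kcomm p q \<in> carrier_mat (p * q) (p * q)"
  by (simp add: Kcomm_def)

lemma sum_delta_shift:
  fixes f :: "nat \<Rightarrow> real"
  shows "(\<Sum>k<m. (if i = k + r then 1 else 0) * f k)
    = (if r \<le> i \<and> i < r + m then f (i - r) else 0)"
proof (cases "r \<le> i \<and> i < r + m")
  case True
  then have "(\<Sum>k<m. (if i = k + r then 1 else 0) * f k) = (\<Sum>k<m. if k = i - r then f k else 0)"
    by (intro sum.cong) auto
  then show ?thesis using True by auto
qed (auto intro!: sum.neutral)

context
  fixes n r :: nat
  assumes rn: "r \<le> n"
begin

lemma block_embed_index:
  assumes B: "B \<in> carrier_mat (n - r) r" and ij: "i < n" "j < n"
  shows "(transpose_mat (Theta2 n r) * (B * transpose_mat (Ipr n r))) $$ (i, j)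
       = (if r \<le> i \<and> j < r then B $$ (i - r, j) else 0)"
proof -
  define N where "N = B * transpose_mat (Ipr n r)"
  have N: "N \<in> carrier_mat (n - r) n" using B by (simp add: N_def mult_carrier_mat[of _ _ r])
  have N_index: "N $$ (k, j) = (if j < r then B $$ (k, j) else 0)" if k: "k < n - r" for k
  proof -
    have "N $$ (k, j) = (\<Sum>l<r. B $$ (k, l) * (if j = l then 1 else 0))"
      using B k ij by (simp add: N_def scalar_prod_def lessThan_atLeast0 Ipr_def)
    then show ?thesis by (simp add: if_distrib cong: if_cong)
  qed
  have "(transpose_mat (Theta2 n r) * N) $$ (i, j)
      = (\<Sum>k<n - r. (if i = k + r then 1 else 0) * N $$ (k, j))"
    using N ij by (simp add: scalar_prod_def lessThan_atLeast0 Theta2_def)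
  then show ?thesis using N_index ij rn by (simp add: sum_delta_shift flip: N_def)
qed

lemma Ipr_isometry: "transpose_mat (Ipr n r) * Ipr n r = 1\<^sub>m r"
proof (rule eq_matI)
  fix i j assume "i < dim_row (1\<^sub>m r)" "j < dim_col (1\<^sub>m r)"
  then have ij: "i < r" "j < r" by simp_all
  have "(transpose_mat (Ipr n r) * Ipr n r) $$ (i, j)
      = (\<Sum>k<n. (if k = i then 1 else 0) * (if k = j then 1 else 0))"
    using ij by (simp add: Ipr_def scalar_prod_def lessThan_atLeast0)
  also have "\<dots> = (\<Sum>k<n. if k = i then if k = j then 1 else 0 else 0)"
    by (intro sum.cong) auto
  finally show "(transpose_mat (Ipr n r) * Ipr n r) $$ (i, j) = 1\<^sub>m r $$ (i, j)"
    using ij rn by simp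
qed (simp_all add: Ipr_def)

lemma Theta2_isometry: "Theta2 n r * transpose_mat (Theta2 n r) = 1\<^sub>m (n - r)"
proof (rule eq_matI)
  fix i j assume "i < dim_row (1\<^sub>m (n - r))" "j < dim_col (1\<^sub>m (n - r))"
  then have ij: "i < n - r" "j < n - r" by simp_all
  have "(Theta2 n r * transpose_mat (Theta2 n r)) $$ (i, j)
      = (\<Sum>k<n. (if k = i + r then 1 else 0) * (if k = j + r then 1 else 0))"
    using ij by (simp add: Theta2_def scalar_prod_def lessThan_atLeast0)
  also have "\<dots> = (\<Sum>k<n. if k = i + r then if k = j + r then 1 else 0 else 0)"
    by (intro sum.cong) auto
  finally show "(Theta2 n r * transpose_mat (Theta2 n r)) $$ (i, j) = 1\<^sub>m (n - r) $$ (i, j)"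
    using ij rn by simp
qed (simp_all add: Theta2_def)

lemma Theta2_Ipr: "Theta2 n r * Ipr n r = 0\<^sub>m (n - r) r"
  by (rule eq_matI) (auto simp: Theta2_def Ipr_def scalar_prod_def intro!: sum.neutral)

text \<open>Places \<open>B\<close> in the lower left block. It is written as a product because this
  is the form in which the Kronecker factor of \<open>Gam\<close> delivers it.\<close>

definition embed :: "real mat \<Rightarrow> real mat" where
  "embed B = transpose_mat (Theta2 n r) * (B * transpose_mat (Ipr n r))"

lemma embed_carrier: "B \<in> carrier_mat (n - r) r \<Longrightarrow> embed B \<in> carrier_mat n n"
  by (simp add: embed_def mult_carrier_mat[of _ _ "n - r"] mult_carrier_mat[of _ _ r])

lemma Xphi_eq_embed:
  assumes "A \<in> carrier_mat (n - r) r"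
  shows "Xphi n r A = embed A - transpose_mat (embed A)"
  using embed_carrier[OF assms]
  by (intro eq_matI) (auto simp: Xphi_def embed_def block_embed_index[OF assms] simp del: index_mult_mat(1))

lemma frob_embed:
  assumes B: "B \<in> carrier_mat (n - r) r"
  shows "frob (embed B) = frob B"
proof -
  have BE: "B * transpose_mat (Ipr n r) \<in> carrier_mat (n - r) n"
    using B by (simp add: mult_carrier_mat[of _ _ r])
  have "frob (embed B) = frob (B * transpose_mat (Ipr n r))"
    unfolding embed_def using BE Theta2_isometry by (intro frob_mult_isometry[of _ n "n - r" _ n]) auto
  also have "\<dots> = frob (Ipr n r * transpose_mat B)"
    using transpose_mult[OF B, of "transpose_mat (Ipr n r)" n] by (metis frob_transpose transpose_transpose
      Ipr_carrier transpose_carrier_mat)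
  also have "\<dots> = frob B"
    using frob_mult_isometry[OF Ipr_carrier _ Ipr_isometry, of "transpose_mat B" "n - r"] B by simp
  finally show ?thesis .
qed

lemma vnorm_embed_le:
  assumes A: "A \<in> carrier_mat (n - r) r" and v: "v \<in> carrier_vec n" and k: "0 \<le> k"
    and le: "\<And>u. u \<in> carrier_vec r \<Longrightarrow> vnorm (A *\<^sub>v u) \<le> k * vnorm u"
  shows "vnorm (embed A *\<^sub>v v) \<le> k * vnorm v"
proof -
  define u where "u = transpose_mat (Ipr n r) *\<^sub>v v"
  have u: "u \<in> carrier_vec r" using v by (simp add: u_def mult_mat_vec_carrier[of _ r n])
  have tE: "transpose_mat (Ipr n r) \<in> carrier_mat r n" by simp
  have AE: "A * transpose_mat (Ipr n r) \<in> carrier_mat (n - r) n" using A tE by (rule mult_carrier_mat)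
  have tT: "transpose_mat (Theta2 n r) \<in> carrier_mat n (n - r)" by simp
  have "embed A *\<^sub>v v = transpose_mat (Theta2 n r) *\<^sub>v (A *\<^sub>v u)"
    unfolding embed_def u_def using assoc_mult_mat_vec[OF tT AE v] assoc_mult_mat_vec[OF A tE v] by simp
  then have "vnorm (embed A *\<^sub>v v) = vnorm (A *\<^sub>v u)"
    using vnorm_mult_isometry[OF tT, of "A *\<^sub>v u"] Theta2_isometry A u by simp
  also have "\<dots> \<le> k * vnorm u" using le u by simp
  also have "vnorm u \<le> vnorm v"
    using vnorm_transpose_mult_le[OF Ipr_carrier v, of 1 r] vnorm_mult_isometry[OF Ipr_carrier Ipr_isometry]
    by (simp add: u_def)
  finally show ?thesis using k by (simp add: mult_left_mono)
qed

section \<open>The coordinate projection and the concrete block structure\<close>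

abbreviation "Proj \<equiv> Ipr n r * transpose_mat (Ipr n r)"

lemma Proj_carrier: "Proj \<in> carrier_mat n n"
  by (simp add: mult_carrier_mat[of _ _ r])

lemma Proj_transpose: "transpose_mat Proj = Proj"
  by (simp add: transpose_mult[of _ n r _ n])

lemma Proj_Ipr: "transpose_mat (Ipr n r) * Proj = transpose_mat (Ipr n r)"
  using assoc_mult_mat[of "transpose_mat (Ipr n r)" r n "Ipr n r" r "transpose_mat (Ipr n r)" n]
  by (simp add: Ipr_isometry)

lemma Proj_idem: "Proj * Proj = Proj"
  using assoc_mult_mat[of "Ipr n r" n r "transpose_mat (Ipr n r)" n Proj n] Proj_carrier Proj_Ipr by simp

lemma embed_Proj:
  assumes B: "B \<in> carrier_mat (n - r) r"
  shows "embed B * Proj = embed B" "Proj * embed B = 0\<^sub>m n n"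
proof -
  have tE: "transpose_mat (Ipr n r) \<in> carrier_mat r n" by simp
  have BE: "B * transpose_mat (Ipr n r) \<in> carrier_mat (n - r) n" using B tE by (rule mult_carrier_mat)
  have tT: "transpose_mat (Theta2 n r) \<in> carrier_mat n (n - r)" by simp
  show "embed B * Proj = embed B"
    unfolding embed_def
    using assoc_mult_mat[OF tT BE Proj_carrier] assoc_mult_mat[OF B tE Proj_carrier] Proj_Ipr by simp
  have "transpose_mat (Ipr n r) * transpose_mat (Theta2 n r) = 0\<^sub>m r (n - r)"
    using transpose_mult[of "Theta2 n r" "n - r" n "Ipr n r" r] Theta2_Ipr by simp
  then have "transpose_mat (Ipr n r) * embed B = 0\<^sub>m r n"
    unfolding embed_def using assoc_mult_mat[OF tE tT BE] left_mult_zero_mat[OF BE] by simp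
  then show "Proj * embed B = 0\<^sub>m n n"
    using assoc_mult_mat[OF Ipr_carrier tE embed_carrier[OF B]] by simp
qed

text \<open>Reduces the symmetry required by \<open>frob_G_le_sym\<close> to symmetry of the small
  matrix \<open>A^T B\<close>.\<close>

lemma embed_transpose_mult:
  assumes A: "A \<in> carrier_mat (n - r) r" and B: "B \<in> carrier_mat (n - r) r"
  shows "transpose_mat (embed A) * embed B
       = Ipr n r * ((transpose_mat A * B) * transpose_mat (Ipr n r))"
proof -
  have tE: "transpose_mat (Ipr n r) \<in> carrier_mat r n" by simp
  have AE: "A * transpose_mat (Ipr n r) \<in> carrier_mat (n - r) n" using A tE by (rule mult_carrier_mat)
  have BE: "B * transpose_mat (Ipr n r) \<in> carrier_mat (n - r) n" using B tE by (rule mult_carrier_mat)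
  have tT: "transpose_mat (Theta2 n r) \<in> carrier_mat n (n - r)" by simp
  have EA: "Ipr n r * transpose_mat A \<in> carrier_mat n (n - r)" using A by (simp add: mult_carrier_mat[of _ _ r])
  have "transpose_mat (embed A) = (Ipr n r * transpose_mat A) * Theta2 n r"
    unfolding embed_def using transpose_mult[OF tT AE] transpose_mult[OF A tE] by simp
  then have "transpose_mat (embed A) * embed B
      = (Ipr n r * transpose_mat A) * (Theta2 n r * embed B)"
    using assoc_mult_mat[OF EA Theta2_carrier[of n r] embed_carrier[OF B]] by simp
  also have "Theta2 n r * embed B = B * transpose_mat (Ipr n r)"
    unfolding embed_def using assoc_mult_mat[OF Theta2_carrier[of n r] tT BE] left_mult_one_mat[OF BE] Theta2_isometry
    by simp
  finally show ?thesis
    using assoc_mult_mat[of "Ipr n r" n r "transpose_mat A" "n - r" "B * transpose_mat (Ipr n r)" n]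
      assoc_mult_mat[of "transpose_mat A" r "n - r" B r "transpose_mat (Ipr n r)" n] A B BE by simp
qed

lemma cayley_blocks_embed:
  assumes A: "A \<in> carrier_mat (n - r) r" and B: "B \<in> carrier_mat (n - r) r" and r: "0 < r"
  shows "cayley_blocks n Proj (embed B) (embed A) (minv (1\<^sub>m n - Xphi n r A)) (spec_norm A)"
proof -
  have X: "Xphi n r A \<in> carrier_mat n n" by (simp add: Xphi_def)
  have "transpose_mat (Xphi n r A) = - Xphi n r A"
    by (rule eq_matI) (auto simp: Xphi_def)
  note C = skew_minv[OF X this]
  show ?thesis
    by unfold_locales (use C Proj_carrier embed_carrier[OF A] embed_carrier[OF B] Proj_transpose Proj_idem
      embed_Proj[OF A] embed_Proj[OF B] spec_norm_nonneg[OF A r] vnorm_embed_le[OF A]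
      vnorm_mult_le_spec_norm[OF A] Xphi_eq_embed[OF A] in auto)
qed

text \<open>\<open>Gam\<close> is the constant Jacobian of the linear map from \<open>vec A\<close>
  to the vectorized skew matrix: the Kronecker factor embeds the block, and \<open>1 - K\<close>
  subtracts the transpose.\<close>

lemma Gam_mult_mvec:
  assumes B: "B \<in> carrier_mat (n - r) r"
  shows "Gam n r *\<^sub>v mvec B = mvec (embed B - transpose_mat (embed B))"
proof -
  let ?k = "kron (transpose_mat (Theta1 n r)) (transpose_mat (Theta2 n r))"
  have k: "?k \<in> carrier_mat (n * n) (r * (n - r))"
    using kron_carrier[of "transpose_mat (Theta1 n r)" "transpose_mat (Theta2 n r)"]
    by (simp add: Theta1_def Ipr_def Theta2_def)
  have v: "mvec B \<in> carrier_vec (r * (n - r))" using B by (auto intro!: carrier_vecI simp: mult.commute)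
  have w: "mvec (embed B) \<in> carrier_vec (n * n)" using embed_carrier[OF B] by (auto intro!: carrier_vecI)
  have "?k *\<^sub>v mvec B = mvec (transpose_mat (Theta2 n r) * B * transpose_mat (Ipr n r))"
    using kron_mult_mvec[of "Ipr n r" n r "transpose_mat (Theta2 n r)" n "n - r" B] B by (simp add: Theta1_def)
  also have "transpose_mat (Theta2 n r) * B * transpose_mat (Ipr n r) = embed B"
    unfolding embed_def using B by (intro assoc_mult_mat[of _ n "n - r" _ r _ n]) auto
  finally have kB: "?k *\<^sub>v mvec B = mvec (embed B)" .
  have "Gam n r *\<^sub>v mvec B = (1\<^sub>m (n * n) - Kcomm n n) *\<^sub>v mvec (embed B)"
    unfolding Gam_def kB[symmetric]
    using k v by (intro assoc_mult_mat_vec[of _ "n * n" "n * n" _ "r * (n - r)"]) (auto simp: minus_carrier_mat)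
  also have "\<dots> = mvec (embed B) - Kcomm n n *\<^sub>v mvec (embed B)"
    using w by (subst minus_mult_distrib_mat_vec[of _ "n * n" "n * n"]) auto
  also have "Kcomm n n *\<^sub>v mvec (embed B) = mvec (transpose_mat (embed B))"
    using embed_carrier[OF B] by (rule Kcomm_mult_mvec)
  also have "mvec (embed B) - mvec (transpose_mat (embed B)) = mvec (embed B - transpose_mat (embed B))"
    using embed_carrier[OF B] by (intro eq_vecI) (auto simp: mvec_index div_mod_bounds)
  finally show ?thesis .
qed

lemma Gam_carrier: "Gam n r \<in> carrier_mat (n * n) (r * (n - r))"
  unfolding Gam_def
  using kron_carrier[of "transpose_mat (Theta1 n r)" "transpose_mat (Theta2 n r)"]
  by (intro mult_carrier_mat[of _ _ "n * n"]) (auto simp: Theta1_def Ipr_def Theta2_def minus_carrier_mat)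

text \<open>The expected derivative: \<open>(1 + X) C = 2 C - 1\<close>, so the variation of the
  Cayley transform is \<open>2 C dX C\<close>, restricted here to the first r columns.\<close>

lemma DU_mult_mvec:
  assumes A: "A \<in> carrier_mat (n - r) r" and B: "B \<in> carrier_mat (n - r) r"
    and C: "C = minv (1\<^sub>m n - Xphi n r A)" "C \<in> carrier_mat n n"
  shows "DU n r A \<in> carrier_mat (r * n) (r * (n - r))"
    "DU n r A *\<^sub>v mvec B
       = mvec (2 \<cdot>\<^sub>m (C * ((embed B - transpose_mat (embed B)) * (C * Ipr n r))))"
proof -
  let ?D = "embed B - transpose_mat (embed B)"
  define P where "P = transpose_mat (Ipr n r) * transpose_mat C"
  have P: "P \<in> carrier_mat r n" using C(2) by (simp add: P_def mult_carrier_mat[of _ _ n])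
  have tP: "transpose_mat P = C * Ipr n r"
    using C(2) by (simp add: P_def transpose_mult[of _ r n _ n])
  have D: "?D \<in> carrier_mat n n" using embed_carrier[OF B] by (simp add: minus_carrier_mat)
  have k: "kron P C \<in> carrier_mat (r * n) (n * n)" using kron_carrier[of P C] P C(2) by simp
  have v: "mvec B \<in> carrier_vec (r * (n - r))" using B by (auto intro!: carrier_vecI simp: mult.commute)
  have DU: "DU n r A = 2 \<cdot>\<^sub>m (kron P C * Gam n r)" by (simp add: DU_def P_def C(1))
  show "DU n r A \<in> carrier_mat (r * n) (r * (n - r))"
    unfolding DU using k Gam_carrier by (simp add: mult_carrier_mat)
  have "DU n r A *\<^sub>v mvec B = 2 \<cdot>\<^sub>v ((kron P C * Gam n r) *\<^sub>v mvec B)"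
    unfolding DU using mult_carrier_mat[OF k Gam_carrier] v by (rule smult_mat_mult_vec)
  also have "(kron P C * Gam n r) *\<^sub>v mvec B = kron P C *\<^sub>v mvec ?D"
    using assoc_mult_mat_vec[OF k Gam_carrier v] Gam_mult_mvec[OF B] by simp
  also have "\<dots> = mvec (C * ?D * transpose_mat P)" by (rule kron_mult_mvec[OF P C(2) D])
  also have "C * ?D * transpose_mat P = C * (?D * (C * Ipr n r))"
    unfolding tP using C(2) D by (intro assoc_mult_mat[of _ n n _ n _ r]) (auto simp: mult_carrier_mat[of _ _ n])
  finally show "DU n r A *\<^sub>v mvec B = mvec (2 \<cdot>\<^sub>m (C * (?D * (C * Ipr n r))))"
    by (simp add: mvec_smult)
qed

text \<open>The product rule for \<open>M U^T\<close>. The commutation matrix is there because the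
  Kronecker factor yields \<open>dU * M^T\<close>, the transpose of the wanted term.\<close>

lemma DSigma_mult:
  fixes p :: nat
  assumes A: "A \<in> carrier_mat (n - r) r" and B: "B \<in> carrier_mat (n - r) r"
    and M: "M \<in> carrier_mat p r" and m: "m \<in> carrier_mat p r"
    and C: "C = minv (1\<^sub>m n - Xphi n r A)" "C \<in> carrier_mat n n"
  shows "DSigma p n r A M \<in> carrier_mat (n * p) (r * (n - r) + p * r)"
    "DSigma p n r A M *\<^sub>v (mvec B @\<^sub>v mvec m)
      = mvec (m * transpose_mat ((1\<^sub>m n + Xphi n r A) * C * Ipr n r)
          + M * transpose_mat (2 \<cdot>\<^sub>m (C * ((embed B - transpose_mat (embed B)) * (C * Ipr n r)))))"
proof -
  define U where "U = (1\<^sub>m n + Xphi n r A) * C * Ipr n r"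
  define dU where "dU = 2 \<cdot>\<^sub>m (C * ((embed B - transpose_mat (embed B)) * (C * Ipr n r)))"
  have X: "Xphi n r A \<in> carrier_mat n n" by (simp add: Xphi_def)
  have D: "embed B - transpose_mat (embed B) \<in> carrier_mat n n"
    using embed_carrier[OF B] by (simp add: minus_carrier_mat)
  have U: "U \<in> carrier_mat n r"
    using X C(2) by (simp add: U_def mult_carrier_mat[of _ _ n])
  have dU: "dU \<in> carrier_mat n r"
    using D C(2) by (simp add: dU_def mult_carrier_mat[of _ _ n])
  have cayU: "cayU n r A = U" by (simp add: cayU_def U_def C(1))
  note DU = DU_mult_mvec[OF A B C]
  have K: "Kcomm n p \<in> carrier_mat (n * p) (n * p)" by simp
  have k: "kron M (1\<^sub>m n) \<in> carrier_mat (n * p) (r * n)"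
    using kron_carrier[of M "1\<^sub>m n"] M by (simp add: mult.commute)
  have k2: "kron U (1\<^sub>m p) \<in> carrier_mat (n * p) (p * r)"
    using kron_carrier[of U "1\<^sub>m p"] U by (simp add: mult.commute)
  have Kk: "Kcomm n p * kron M (1\<^sub>m n) \<in> carrier_mat (n * p) (r * n)" using K k by (rule mult_carrier_mat)
  have KkD: "Kcomm n p * kron M (1\<^sub>m n) * DU n r A \<in> carrier_mat (n * p) (r * (n - r))"
    using Kk DU(1) by (rule mult_carrier_mat)
  show "DSigma p n r A M \<in> carrier_mat (n * p) (r * (n - r) + p * r)"
    unfolding DSigma_def cayU hcat_def using carrier_matD[OF DU(1)] carrier_matD[OF k2] by simp
  have vB: "mvec B \<in> carrier_vec (r * (n - r))" using B by (auto intro!: carrier_vecI simp: mult.commute)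
  have vm: "mvec m \<in> carrier_vec (p * r)" using m by (auto intro!: carrier_vecI)
  have vdU: "mvec dU \<in> carrier_vec (r * n)" using dU by (auto intro!: carrier_vecI simp: mult.commute)
  have "(Kcomm n p * kron M (1\<^sub>m n) * DU n r A) *\<^sub>v mvec B = (Kcomm n p * kron M (1\<^sub>m n)) *\<^sub>v mvec dU"
    using assoc_mult_mat_vec[OF Kk DU(1) vB] DU(2) by (simp add: dU_def)
  also have "\<dots> = Kcomm n p *\<^sub>v (kron M (1\<^sub>m n) *\<^sub>v mvec dU)"
    by (rule assoc_mult_mat_vec[OF K k vdU])
  also have "kron M (1\<^sub>m n) *\<^sub>v mvec dU = mvec (1\<^sub>m n * dU * transpose_mat M)"
    by (rule kron_mult_mvec[OF M one_carrier_mat dU])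
  also have "1\<^sub>m n * dU * transpose_mat M = dU * transpose_mat M" using dU by simp
  also have "Kcomm n p *\<^sub>v mvec (dU * transpose_mat M) = mvec (transpose_mat (dU * transpose_mat M))"
    using dU M by (intro Kcomm_mult_mvec) (auto simp: mult_carrier_mat[of _ _ r])
  also have "transpose_mat (dU * transpose_mat M) = M * transpose_mat dU"
    using dU M by (simp add: transpose_mult[of _ n r _ p])
  finally have 1: "(Kcomm n p * kron M (1\<^sub>m n) * DU n r A) *\<^sub>v mvec B = mvec (M * transpose_mat dU)" .
  have 2: "kron U (1\<^sub>m p) *\<^sub>v mvec m = mvec (m * transpose_mat U)"
    using kron_mult_mvec[OF U one_carrier_mat m] m by simp
  have mU: "m * transpose_mat U \<in> carrier_mat p n" and MdU: "M * transpose_mat dU \<in> carrier_mat p n"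
    using m U M dU by (auto intro!: mult_carrier_mat)
  have "DSigma p n r A M *\<^sub>v (mvec B @\<^sub>v mvec m) = mvec (M * transpose_mat dU) + mvec (m * transpose_mat U)"
    unfolding DSigma_def cayU hcat_mult_append[OF KkD k2 vB vm] 1 2 ..
  also have "\<dots> = mvec (m * transpose_mat U + M * transpose_mat dU)"
    unfolding mvec_add[OF mU MdU] by (rule comm_add_vec[OF mvec_carrier[OF MdU] mvec_carrier[OF mU]])
  finally show "DSigma p n r A M *\<^sub>v (mvec B @\<^sub>v mvec m) = mvec (m * transpose_mat U + M * transpose_mat dU)" .
qed

text \<open>\<open>\<kappa>\<close> is the constant in
  \<open>\<kappa> * frob B \<le> frob V\<close>: the general block estimate for
  \<open>r \<ge> 2\<close>, the symmetric one for \<open>r = 1\<close>.\<close>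

lemma DSigma_lower_bound:
  fixes p :: nat
  assumes A: "A \<in> carrier_mat (n - r) r" "spec_norm A < 1" and r: "0 < r"
    and M: "M \<in> carrier_mat p r" and z: "z \<in> carrier_vec (r * (n - r) + p * r)"
    and \<sigma>: "0 < \<sigma>" "\<And>v. v \<in> carrier_vec r \<Longrightarrow> \<sigma> * vnorm v \<le> vnorm (M *\<^sub>v v)"
  defines "\<kappa> \<equiv> if 2 \<le> r then (1 - (spec_norm A)\<^sup>2) / (1 + (spec_norm A)\<^sup>2)\<^sup>2 else 1 / (1 + (spec_norm A)\<^sup>2)"
  shows "(vnorm z)\<^sup>2 \<le> (1 + (1 + 8 * (spec_norm M)\<^sup>2) / (4 * \<sigma>\<^sup>2 * \<kappa>\<^sup>2)) * (vnorm (DSigma p n r A M *\<^sub>v z))\<^sup>2"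
proof -
  define \<alpha> where "\<alpha> = spec_norm A"
  have \<alpha>: "0 \<le> \<alpha>" "\<alpha> < 1" using spec_norm_nonneg[OF A(1) r] A(2) by (auto simp: \<alpha>_def)
  have \<alpha>2: "\<alpha>\<^sup>2 < 1" using \<alpha> by (simp add: power_less_one_iff abs_square_less_1)
  have \<alpha>3: "0 < 1 + \<alpha>\<^sup>2" by (simp add: add_pos_nonneg)
  have \<kappa>: "0 < \<kappa>" using \<alpha>2 \<alpha>3 by (simp add: \<kappa>_def flip: \<alpha>_def)
  \<comment> \<open>Every vector is a stacked pair of vectorized increments \<open>B\<close> and
    \<open>m\<close>, so the estimate can be carried out on matrices.\<close>
  define z1 z2 where "z1 = vec_first z (r * (n - r))" and "z2 = vec_last z (p * r)"
  have z_eq: "z = z1 @\<^sub>v z2" unfolding z1_def z2_def using z by simp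
  obtain B where B: "B \<in> carrier_mat (n - r) r" "mvec B = z1"
    using mvec_surj[of z1 "n - r" r] by (auto simp: z1_def mult.commute)
  obtain m where m: "m \<in> carrier_mat p r" "mvec m = z2"
    using mvec_surj[of z2 p r] by (auto simp: z2_def)
  define C where "C = minv (1\<^sub>m n - Xphi n r A)"
  interpret cayley_blocks n Proj "embed B" "embed A" C \<alpha>
    unfolding C_def \<alpha>_def using A(1) B(1) r by (rule cayley_blocks_embed)
  have X: "Xphi n r A = X" by (simp add: X_def Xphi_eq_embed[OF A(1)])
  have "(vnorm (DSigma p n r A M *\<^sub>v z))\<^sup>2
      = (frob (m * transpose_mat ((1\<^sub>m n + X) * C * Ipr n r)
          + M * transpose_mat (2 \<cdot>\<^sub>m (C * (\<Delta> * (C * Ipr n r))))))\<^sup>2"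
    unfolding z_eq B(2)[symmetric] m(2)[symmetric] DSigma_mult(2)[OF A(1) B(1) M m(1) C_def carrier(4)]
    by (simp add: X \<Delta>_def)
  also have "\<dots> = (frob (m * transpose_mat (Ipr n r) - 2 \<cdot>\<^sub>m (M * (transpose_mat (Ipr n r) * W))))\<^sup>2"
    by (subst rotate_tangent[OF Ipr_carrier M m(1)]) simp
  finally have Dz: "(vnorm (DSigma p n r A M *\<^sub>v z))\<^sup>2
     = (frob (m * transpose_mat (Ipr n r) - 2 \<cdot>\<^sub>m (M * (transpose_mat (Ipr n r) * W))))\<^sup>2" .
  obtain x y where xy: "(vnorm (DSigma p n r A M *\<^sub>v z))\<^sup>2 = x\<^sup>2 + y\<^sup>2" "0 \<le> x"
      "frob m \<le> x + 2 * spec_norm M * frob W" "2 * \<sigma> * frob V \<le> y"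
    unfolding Dz
    by (rule tangent_lower_bound[OF Ipr_carrier Ipr_isometry refl M m(1) vnorm_mult_le_spec_norm[OF M]
          spec_norm_nonneg[OF M r] \<sigma>(2) less_imp_le[OF \<sigma>(1)]])
  have G: "frob (embed B) = frob B" by (rule frob_embed[OF B(1)])
  have V: "\<kappa> * frob B \<le> frob V"
  proof (cases "2 \<le> r")
    case True
    then show ?thesis
      using frob_G_le \<alpha>3 by (simp add: \<kappa>_def G field_simps flip: \<alpha>_def)
  next
    case False
    \<comment> \<open>Now \<open>A^T B\<close> is a 1 by 1 matrix, hence symmetric, and the sharper
      estimate is available.\<close>
    then have r1: "r = 1" using r by simp
    have AB: "transpose_mat A * B \<in> carrier_mat 1 1"
      using A(1) B(1) r1 by (auto intro!: mult_carrier_mat)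
    have "transpose_mat D = D" if "D \<in> carrier_mat 1 1" for D :: "real mat"
      using that by (intro eq_matI) auto
    then have ABs: "transpose_mat (transpose_mat A * B) = transpose_mat A * B" using AB .
    have "transpose_mat (transpose_mat (embed A) * embed B) = transpose_mat (embed A) * embed B"
    proof -
      define D where "D = transpose_mat A * B"
      have D: "D \<in> carrier_mat 1 1" "transpose_mat D = D" using AB ABs by (simp_all add: D_def)
      have E: "Ipr n r \<in> carrier_mat n 1" using r1 by simp
      have tE: "transpose_mat (Ipr n r) \<in> carrier_mat 1 n" using E by simp
      have DE: "D * transpose_mat (Ipr n r) \<in> carrier_mat 1 n" using D(1) tE by (rule mult_carrier_mat)
      show ?thesis
        unfolding embed_transpose_mult[OF A(1) B(1)] D_def[symmetric]
        using transpose_mult[OF E DE] transpose_mult[OF D(1) tE] D(2) assoc_mult_mat[OF E D(1) tE] by simp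
    qed
    from frob_G_le_sym[OF this] show ?thesis
      using False \<alpha>3 by (simp add: \<kappa>_def G field_simps flip: \<alpha>_def)
  qed
  have "(frob m)\<^sup>2 + (frob B)\<^sup>2 \<le> (1 + (1 + 8 * (spec_norm M)\<^sup>2) / (4 * \<sigma>\<^sup>2 * \<kappa>\<^sup>2)) * (x\<^sup>2 + y\<^sup>2)"
    using frob_W_le
    by (intro tangent_bound_arith[OF \<sigma>(1) \<kappa> spec_norm_nonneg[OF M r] _ _ _ xy(2) V xy(4) _ xy(3)])
       (simp_all add: G)
  moreover have "(vnorm z)\<^sup>2 = (frob m)\<^sup>2 + (frob B)\<^sup>2"
    unfolding z_eq vnorm_append_sq B(2)[symmetric] m(2)[symmetric] by simp
  ultimately show ?thesis using xy(1) by simp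
qed

end

theorem theorem8:
  fixes p1 p2 r :: nat and A0 M0 :: "real mat"
  assumes "1 \<le> r" and "r \<le> p1" and "r \<le> p2"
    and "A0 \<in> carrier_mat (p2 - r) r" and "spec_norm A0 < 1"
    and "M0 \<in> carrier_mat p1 r" and "vec_space.rank p1 M0 = r"
  shows "invertible_mat (transpose_mat (DSigma p1 p2 r A0 M0) * DSigma p1 p2 r A0 M0) \<and>
         spec_norm (minv (transpose_mat (DSigma p1 p2 r A0 M0) * DSigma p1 p2 r A0 M0)) \<le>
           (if 2 \<le> r then
              1 + (1 + 8 * (spec_norm M0)^2) * (1 + (spec_norm A0)^2)^4
                  / (4 * (sing_val M0 r)^2 * (1 - (spec_norm A0)^2)^2)
            else
              1 + (1 + 8 * (spec_norm M0)^2) * (1 + (spec_norm A0)^2)^2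
                  / (4 * (sing_val M0 r)^2))"
proof -
  have r: "0 < r" using assms(1) by simp
  note inj = full_column_rank_injective[OF assms(6,7)]
  note \<sigma> = sing_val_lower_bound[OF assms(6) r inj]
  define \<kappa> where "\<kappa> = (if 2 \<le> r then (1 - (spec_norm A0)\<^sup>2) / (1 + (spec_norm A0)\<^sup>2)\<^sup>2
    else 1 / (1 + (spec_norm A0)\<^sup>2))"
  define K where "K = 1 + (1 + 8 * (spec_norm M0)\<^sup>2) / (4 * (sing_val M0 r)\<^sup>2 * \<kappa>\<^sup>2)"
  \<comment> \<open>Only the dimensions matter in this and the next claim, so \<open>A0\<close> and
    \<open>M0\<close> themselves serve as increments.\<close>
  have C: "minv (1\<^sub>m p2 - Xphi p2 r A0) \<in> carrier_mat p2 p2"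
    using cayley_blocks.carrier(4)[OF cayley_blocks_embed[OF assms(3,4,4) r]] .
  have D: "DSigma p1 p2 r A0 M0 \<in> carrier_mat (p2 * p1) (r * (p2 - r) + p1 * r)"
    by (rule DSigma_mult(1)[OF assms(3,4,4,6,6) refl C])
  have dim: "0 < r * (p2 - r) + p1 * r" using r assms(2) by simp
  have lower: "(vnorm z)\<^sup>2 \<le> K * (vnorm (DSigma p1 p2 r A0 M0 *\<^sub>v z))\<^sup>2"
    if "z \<in> carrier_vec (r * (p2 - r) + p1 * r)" for z
    unfolding K_def \<kappa>_def by (rule DSigma_lower_bound[OF assms(3,4,5) r assms(6) that \<sigma>])
  have "K = (if 2 \<le> r then
              1 + (1 + 8 * (spec_norm M0)^2) * (1 + (spec_norm A0)^2)^4
                  / (4 * (sing_val M0 r)^2 * (1 - (spec_norm A0)^2)^2)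
            else
              1 + (1 + 8 * (spec_norm M0)^2) * (1 + (spec_norm A0)^2)^2
                  / (4 * (sing_val M0 r)^2))"
    by (simp add: K_def \<kappa>_def power_divide flip: power_mult)
  then show ?thesis using spec_norm_minv_gram_le[OF D dim lower] by simp
qed

end
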